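(* Let $n\geq 4$ be an integer. Then $$cr(K_m\times P_n)\leq \frac{(n-1)m(m-1)(m-2)(m-3)}{6}-\frac{m(m-3)(m^2+6m-31)}{24}\quad\text{for every odd } m\geq 5,$$ and $$cr(K_m\times P_n)\leq \frac{(n-1)m(m-1)(m-2)(m-3)}{6}-\frac{m(m-4)(m^2+10m-48)}{24}\quad\text{for every even } m\geq 4.$$
   Context: The crossing number $cr(G)$ of a graph $G$ is the smallest number of pairwise crossings of edges among all drawings of $G$ in the plane. $K_m$ is the complete graph on $m$ vertices and $P_n$ is the path on $n$ vertices. $\times$ denotes the Kronecker (direct) product: $V(G\times H)=V(G)\times V(H)$ and $E(G\times H)=\{\{(a,x),(b,y)\}:\{a,b\}\in E(G)\text{ and }\{x,y\}\in E(H)\}$. Thus $K_m\times P_n$ has vertices $(i,j)$ with $0\le i\le m-1$, $0\le j\le n-1$, and edges $\{(i_1,j),(i_2,j+1)\}$ for $0\le i_1\ne i_2\le m-1$, $0\le j\le n-2$. *)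

theory Defs
  imports "HOL-Analysis.Analysis"
begin

record 'a ugraph =
  uverts :: "'a set"
  uedges :: "'a set set"

definition complete_graph :: "nat \<Rightarrow> nat ugraph" where
  "complete_graph m = \<lparr>uverts = {..<m}, uedges = {{a, b} | a b. a < m \<and> b < m \<and> a \<noteq> b}\<rparr>"

text \<open>The path on \<open>n\<close> vertices, hence with \<open>n - 1\<close> edges.\<close>

definition path_graph :: "nat \<Rightarrow> nat ugraph" where
  "path_graph n = \<lparr>uverts = {..<n}, uedges = {{j, Suc j} | j. Suc j < n}\<rparr>"

definition kronecker_product :: "'a ugraph \<Rightarrow> 'b ugraph \<Rightarrow> ('a \<times> 'b) ugraph" where
  "kronecker_product G H = \<lparr>uverts = uverts G \<times> uverts H,
     uedges = {{(a, x), (b, y)} | a b x y. {a, b} \<in> uedges G \<and> {x, y} \<in> uedges H}\<rparr>"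

text \<open>
  A crossing is a pair of distinct edges together with a common point of their curves that is not
  the image of a vertex. A point common to \<open>k\<close> edges therefore contributes \<open>k choose 2\<close> crossings,
  and two edges meeting at several points contribute one crossing per point. A point where two
  edges merely touch also counts as a crossing; this does not affect the minimum, since such a
  contact can be removed by a local perturbation.
\<close>

definition crossings ::
  "'a ugraph \<Rightarrow> ('a \<Rightarrow> complex) \<Rightarrow> ('a set \<Rightarrow> real \<Rightarrow> complex) \<Rightarrow> ('a set set \<times> complex) set" where
  "crossings G pos crv = {({e, f}, p) | e f p. e \<in> uedges G \<and> f \<in> uedges G \<and> e \<noteq> f \<and>
     p \<in> path_image (crv e) \<inter> path_image (crv f) - pos ` uverts G}"

text \<open>
  Vertices are distinct points and edges are simple arcs joining their end vertices and passing
  through no other vertex. Finiteness excludes curves that overlap along an arc; without it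
  \<^const>\<open>card\<close> would count infinitely many crossings as 0.
\<close>

definition drawing ::
  "'a ugraph \<Rightarrow> ('a \<Rightarrow> complex) \<Rightarrow> ('a set \<Rightarrow> real \<Rightarrow> complex) \<Rightarrow> bool" where
  "drawing G pos crv \<longleftrightarrow>
     inj_on pos (uverts G) \<and>
     (\<forall>e\<in>uedges G. arc (crv e) \<and> {pathstart (crv e), pathfinish (crv e)} = pos ` e \<and>
        path_image (crv e) \<inter> pos ` uverts G = pos ` e) \<and>
     finite (crossings G pos crv)"

definition crossing_number :: "'a ugraph \<Rightarrow> nat" where
  "crossing_number G = (LEAST k. \<exists>pos crv. drawing G pos crv \<and> card (crossings G pos crv) = k)"

end

theory Submission
  imports Defs
begin

text \<open>
  All layers of vertices but the first and the last lie on concentric circles, and the edges between two of these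
  circles are logarithmic spirals that turn counterclockwise by \<open>k\<close> of \<open>m\<close> steps, where \<open>0 < k < m\<close>. A crossing is
  determined by the starting point of one of the two spirals, their numbers of steps and an integer strictly
  between these, so there are at most \<open>m * ((m - 1) choose 3)\<close> crossings in each annulus.

  The first layer is a regular polygon shrunk to a tiny circle around the origin and joined by straight segments to
  the innermost of the other circles. Two segments from \<open>x\<close> and \<open>x'\<close> to rim points \<open>p\<close> and \<open>p'\<close> can only cross if
  \<open>p\<close> and \<open>p'\<close> lie on the same side of the line \<open>x x'\<close>, in one of the two orders. As these lines nearly halve the
  rim, there are only about \<open>m ^ 4 / 8\<close> crossings instead of \<open>m ^ 4 / 6\<close>. The last layer is the image of
  the first one under an inversion.
\<close>

subsection \<open>Counting cells\<close>

lemma card_int_pairs: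
  "card {(k, l). L \<le> k \<and> k < l \<and> l < L + int N} = N choose 2"
proof (induction N)
  case 0
  have "{(k, l). L \<le> k \<and> k < l \<and> l < L + int 0} = {}" by auto
  then show ?case by (metis card.empty binomial_eq_0 zero_less_numeral)
next
  case (Suc N)
  let ?S = "{(k, l). L \<le> k \<and> k < l \<and> l < L + int N}" and ?T = "{L..<L + int N} \<times> {L + int N}"
  have "finite ?S"
    by (rule finite_subset[of _ "{L..L + int N} \<times> {L..L + int N}"]) auto
  moreover have "{(k, l). L \<le> k \<and> k < l \<and> l < L + int (Suc N)} = ?S \<union> ?T" by auto
  moreover have "?S \<inter> ?T = {}" by auto
  ultimately have "card {(k, l). L \<le> k \<and> k < l \<and> l < L + int (Suc N)} = card ?S + card ?T"
    by (simp add: card_Un_disjoint)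
  also have "\<dots> = Suc N choose 2"
    using Suc by (simp add: card_cartesian_product numeral_2_eq_2)
  finally show ?case .
qed

lemma card_nat_pairs: "card {(x, y). x < y \<and> y < N} = N choose 2" for N :: nat
proof (induction N)
  case (Suc N)
  let ?S = "{(x, y). x < y \<and> y < N}" and ?T = "{..<N} \<times> {N}"
  have "finite ?S" by (rule finite_subset[of _ "{..N} \<times> {..N}"]) auto
  moreover have "{(x, y). x < y \<and> y < Suc N} = ?S \<union> ?T" by auto
  moreover have "?S \<inter> ?T = {}" by auto
  ultimately show ?case
    using Suc by (simp add: card_Un_disjoint card_cartesian_product numeral_2_eq_2)
qed simp

lemma card_nat_triples: "card {(x, y, z). x < y \<and> y < z \<and> z < N} = N choose 3" for N :: nat
proof (induction N)
  case (Suc N)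
  let ?S = "{(x, y, z). x < y \<and> y < z \<and> z < N}"
    and ?T = "(\<lambda>(x, y). (x, y, N)) ` {(x, y). x < y \<and> y < N}"
  have "finite ?S" by (rule finite_subset[of _ "{..N} \<times> {..N} \<times> {..N}"]) auto
  moreover have "finite {(x, y). x < y \<and> y < N}"
    by (rule finite_subset[of _ "{..N} \<times> {..N}"]) auto
  moreover have "{(x, y, z). x < y \<and> y < z \<and> z < Suc N} = ?S \<union> ?T"
    by (auto simp: image_iff less_Suc_eq)
  moreover have "?S \<inter> ?T = {}" by auto
  moreover have "card ?T = N choose 2"
    by (subst card_image) (auto simp: inj_on_def card_nat_pairs)
  ultimately show ?case
    using Suc by (simp add: card_Un_disjoint eval_nat_numeral)
qed simp

text \<open>
  Indices are relative to the central point \<open>i\<close>. The window consists of the rim points to the left of the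
  line from \<open>i\<close> to \<open>i + d\<close>; a cell \<open>(d, k, l)\<close> is a crossing of the segment from \<open>i\<close> to the rim point
  \<open>i + k\<close> with the segment from \<open>i + d\<close> to \<open>i + l\<close>. The conditions \<open>k \<noteq> 0\<close> and \<open>l \<noteq> d\<close> reflect the edges that
  are missing in the Kronecker product.
\<close>

definition window :: "nat \<Rightarrow> int \<Rightarrow> int set" where
  "window m d = (let r = int (m div 2) in
     if even m then {k. d - r \<le> 2 * k \<and> 2 * k < d + r}
     else if d \<le> r then {k. d - r \<le> 2 * k \<and> 2 * k \<le> d + r + 1}
     else {k. d - r < 2 * k \<and> 2 * k < d + r + 1})"

definition cell_pairs :: "nat \<Rightarrow> int \<Rightarrow> (int \<times> int) set" where
  "cell_pairs m d = {(k, l). k \<in> window m d \<and> l \<in> window m d \<and> k < l \<and> k \<noteq> 0 \<and> l \<noteq> d}"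

definition cells :: "nat \<Rightarrow> (int \<times> int \<times> int) set" where
  "cells m = Sigma {1..<int m} (cell_pairs m)"

text \<open>Among \<open>2 * r\<close> consecutive integers exactly \<open>r\<close> are even, among
  \<open>2 * r + 2\<close> exactly \<open>r + 1\<close>. So the length of each interval does not
  depend on \<open>d\<close>; only its left end does, through the rounding.\<close>

lemma halved_intervals:
  fixes d r :: int
  shows "{k. d - r \<le> 2 * k \<and> 2 * k < d + r} = {- ((r - d) div 2)..<- ((r - d) div 2) + r}"
    and "{k. d - r \<le> 2 * k \<and> 2 * k \<le> d + r + 1} = {- ((r - d) div 2)..<- ((r - d) div 2) + (r + 1)}"
    and "{k. d - r < 2 * k \<and> 2 * k < d + r + 1} = {(d - r) div 2 + 1..<(d - r) div 2 + 1 + r}"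
proof -
  define q where "q = (r - d) div 2"
  define p where "p = (d - r) div 2"
  have q: "2 * q \<le> r - d" "r - d \<le> 2 * q + 1" unfolding q_def by presburger+
  have p: "2 * p \<le> d - r" "d - r \<le> 2 * p + 1" unfolding p_def by presburger+
  show "{k. d - r \<le> 2 * k \<and> 2 * k < d + r} = {- ((r - d) div 2)..<- ((r - d) div 2) + r}"
    unfolding q_def[symmetric] using q by (intro set_eqI; simp; presburger)
  show "{k. d - r \<le> 2 * k \<and> 2 * k \<le> d + r + 1} = {- ((r - d) div 2)..<- ((r - d) div 2) + (r + 1)}"
    unfolding q_def[symmetric] using q by (intro set_eqI; simp; presburger)
  show "{k. d - r < 2 * k \<and> 2 * k < d + r + 1} = {(d - r) div 2 + 1..<(d - r) div 2 + 1 + r}"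
    unfolding p_def[symmetric] using p by (intro set_eqI; simp; presburger)
qed

lemma window_even:
  assumes "m = 2 * r"
  shows "window m d = {- ((int r - d) div 2)..<- ((int r - d) div 2) + int r}"
  unfolding window_def Let_def assms by (simp add: halved_intervals)

lemma window_odd_small:
  assumes "m = Suc (2 * r)" "d \<le> int r"
  shows "window m d = {- ((int r - d) div 2)..<- ((int r - d) div 2) + int (r + 1)}"
proof -
  have "m div 2 = r" "odd m" using assms by auto
  then show ?thesis
    unfolding window_def Let_def using assms(2) halved_intervals(2)[of d "int r"] by (simp add: algebra_simps)
qed

lemma window_odd_large:
  assumes "m = Suc (2 * r)" "int r < d"
  shows "window m d = {(d - int r) div 2 + 1..<(d - int r) div 2 + 1 + int r}"
proof -
  have "m div 2 = r" "odd m" using assms by auto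
  then show ?thesis
    unfolding window_def Let_def using assms(2) halved_intervals(3)[of d "int r"] by (simp add: algebra_simps)
qed

lemma finite_window: "finite (window m d)"
proof (cases "even m")
  case True
  then obtain r where "m = 2 * r" by blast
  then show ?thesis using window_even by simp
next
  case False
  then obtain r where r: "m = Suc (2 * r)" using oddE by fastforce
  show ?thesis
    by (cases "d \<le> int r") (simp_all only: window_odd_small[OF r] window_odd_large[OF r] not_le, simp_all)
qed

lemma finite_cell_pairs: "finite (cell_pairs m d)"
  by (rule finite_subset[of _ "window m d \<times> window m d"]) (auto simp: cell_pairs_def finite_window)

lemma finite_cells: "finite (cells m)"
  by (simp add: cells_def finite_cell_pairs)

text \<open>The excluded pairs are those with \<open>k = 0\<close>, numbering \<open>U - 1\<close>,
  and those with \<open>l = d\<close>, numbering \<open>d - L\<close>. The pair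
  \<open>(0, d)\<close> belongs to both families, hence the \<open>+ 1\<close>.\<close>

lemma card_pairs_avoiding_both:
  fixes L U d :: int
  assumes "L \<le> 0" "0 < d" "d < U"
  shows "card {(k, l). k \<in> {L..<U} \<and> l \<in> {L..<U} \<and> k < l \<and> k \<noteq> 0 \<and> l \<noteq> d}
    + nat (U - 1) + nat (d - L) = (nat (U - L) choose 2) + 1"
proof -
  let ?A = "{(k, l). k \<in> {L..<U} \<and> l \<in> {L..<U} \<and> k < l \<and> k \<noteq> 0 \<and> l \<noteq> d}"
  let ?B = "{0::int} \<times> {0<..<U}" and ?C = "({L..<d} - {0}) \<times> {d}"
  have fA: "finite ?A" by (rule finite_subset[of _ "{L..<U} \<times> {L..<U}"]) auto
  have "{(k, l). L \<le> k \<and> k < l \<and> l < L + int (nat (U - L))} = ?A \<union> (?B \<union> ?C)"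
    using assms by auto
  then have "nat (U - L) choose 2 = card (?A \<union> (?B \<union> ?C))" using card_int_pairs[of L] by metis
  also have "\<dots> = card ?A + card (?B \<union> ?C)"
    using fA by (intro card_Un_disjoint) auto
  also have "card (?B \<union> ?C) = card ?B + card ?C"
    by (intro card_Un_disjoint) auto
  also have "card ?B = nat (U - 1)" by (simp add: card_cartesian_product)
  also have "card ?C = nat (d - L) - 1"
    using assms by (simp add: card_cartesian_product)
  finally show ?thesis using assms by simp
qed

text \<open>Here \<open>d\<close> lies beyond the right end, so that only the pairs starting at
  \<open>0\<close> are lost.\<close>

lemma card_pairs_avoiding_left:
  fixes L U d :: int
  assumes "L \<le> 0" "0 < U" "U \<le> d"
  shows "card {(k, l). k \<in> {L..<U} \<and> l \<in> {L..<U} \<and> k < l \<and> k \<noteq> 0 \<and> l \<noteq> d}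
    + nat (U - 1) = nat (U - L) choose 2"
proof -
  let ?A = "{(k, l). k \<in> {L..<U} \<and> l \<in> {L..<U} \<and> k < l \<and> k \<noteq> 0 \<and> l \<noteq> d}"
  let ?B = "{0::int} \<times> {0<..<U}"
  have fA: "finite ?A" by (rule finite_subset[of _ "{L..<U} \<times> {L..<U}"]) auto
  have "{(k, l). L \<le> k \<and> k < l \<and> l < L + int (nat (U - L))} = ?A \<union> ?B"
    using assms by auto
  then have "nat (U - L) choose 2 = card (?A \<union> ?B)" using card_int_pairs[of L] by metis
  also have "\<dots> = card ?A + card ?B"
    using fA by (intro card_Un_disjoint) auto
  also have "card ?B = nat (U - 1)" by (simp add: card_cartesian_product)
  finally show ?thesis by simp
qed

lemma card_pairs_avoiding_le:
  fixes L U d :: int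
  shows "card {(k, l). k \<in> {L..<U} \<and> l \<in> {L..<U} \<and> k < l \<and> k \<noteq> 0 \<and> l \<noteq> d} \<le> nat (U - L) choose 2"
proof -
  have "card {(k, l). k \<in> {L..<U} \<and> l \<in> {L..<U} \<and> k < l \<and> k \<noteq> 0 \<and> l \<noteq> d}
      \<le> card {(k, l). L \<le> k \<and> k < l \<and> l < L + int (nat (U - L))}"
    by (rule card_mono, rule finite_subset[of _ "{L..U} \<times> {L..U}"]) auto
  then show ?thesis using card_int_pairs[of L] by metis
qed

section \<open>The number of cells for even and odd \<open>m\<close>\<close>

lemma sum_int_linear:
  "2 * (\<Sum>d\<in>{1..<1 + int N}. C - d) = 2 * int N * C - int N * (int N + 1)"
proof (induction N)
  case (Suc N)
  have "{1..<1 + int (Suc N)} = insert (1 + int N) {1..<1 + int N}" by auto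
  then show ?case using Suc by (simp add: algebra_simps)
qed simp

lemma int_choose_two: "2 * int (r choose 2) = int r * (int r - 1)"
proof (induction r)
  case (Suc r)
  then show ?case by (simp add: numeral_2_eq_2 algebra_simps)
qed simp

text \<open>Every window has \<open>r\<close> elements. For \<open>d < r\<close> it contains both
  \<open>0\<close> and \<open>d\<close>; for \<open>d = r\<close> it begins at \<open>0\<close> and
  stops just before \<open>d\<close>; for \<open>d > r\<close> all of its pairs are allowed in the
  estimate.\<close>

lemma card_cells_even: "card (cells (2 * r)) \<le> (r - 1) ^ 3"
proof (cases "r = 0")
  case True
  then show ?thesis by (simp add: cells_def)
next
  case r: False
  have W: "cell_pairs (2 * r) d = {(k, l). k \<in> {L..<L + int r} \<and> l \<in> {L..<L + int r} \<and> k < l \<and> k \<noteq> 0 \<and> l \<noteq> d}"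
    if "L = - ((int r - d) div 2)" for L d
    unfolding cell_pairs_def window_even[OF refl, of r d] that ..
  have small: "int (card (cell_pairs (2 * r) d)) \<le> int (r choose 2) - d - int r + 2" if d: "0 < d" "d < int r" for d
  proof -
    define L where "L = - ((int r - d) div 2)"
    have "- (2 * L) \<le> int r - d" "int r - d \<le> - (2 * L) + 1" unfolding L_def by linarith+
    then have L: "L \<le> 0" "d < L + int r" using d by linarith+
    show ?thesis
      using card_pairs_avoiding_both[OF L(1) d(1) L(2)] d L unfolding W[OF L_def] by simp
  qed
  have mid: "int (card (cell_pairs (2 * r) (int r))) \<le> int (r choose 2) - int r + 1"
    using card_pairs_avoiding_left[of 0 "int r" "int r"] r unfolding W[OF refl] by simp
  have large: "int (card (cell_pairs (2 * r) d)) \<le> int (r choose 2)" for d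
    unfolding W[OF refl] by (rule order_trans[OF of_nat_mono[OF card_pairs_avoiding_le]]) simp
  have "int (card (cells (2 * r))) = (\<Sum>d\<in>{1..<2 * int r}. int (card (cell_pairs (2 * r) d)))"
    by (simp add: cells_def card_SigmaI finite_cell_pairs)
  also have "{1..<2 * int r} = {1..<int r} \<union> ({int r} \<union> {int r<..<2 * int r})" using r by auto
  also have "(\<Sum>d\<in>\<dots>. int (card (cell_pairs (2 * r) d))) =
     (\<Sum>d\<in>{1..<int r}. int (card (cell_pairs (2 * r) d))) + (int (card (cell_pairs (2 * r) (int r)))
     + (\<Sum>d\<in>{int r<..<2 * int r}. int (card (cell_pairs (2 * r) d))))"
    by (subst sum.union_disjoint, auto)+
  also have "\<dots> \<le> (\<Sum>d\<in>{1..<int r}. int (r choose 2) - d - int r + 2) + ((int (r choose 2) - int r + 1)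
     + (\<Sum>d\<in>{int r<..<2 * int r}. int (r choose 2)))"
    by (intro add_mono sum_mono small mid large) auto
  finally have *: "int (card (cells (2 * r))) \<le> (\<Sum>d\<in>{1..<int r}. int (r choose 2) - d - int r + 2)
     + ((int (r choose 2) - int r + 1) + (\<Sum>d\<in>{int r<..<2 * int r}. int (r choose 2)))" .
  \<comment> \<open>With \<open>N = r - 1\<close> the rest is a polynomial identity without
    truncated subtraction.\<close>
  obtain N where N: "r = Suc N" using r not0_implies_Suc by blast
  have c: "2 * int (r choose 2) = (int N + 1) * int N"
    unfolding int_choose_two N by simp
  have s: "2 * (\<Sum>d\<in>{1..<int r}. int (r choose 2) - d - int r + 2)
    = 2 * int N * (int (r choose 2) - int N + 1) - int N * (int N + 1)"
    using sum_int_linear[of "int (r choose 2) - int N + 1" N]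
    unfolding N by (simp add: algebra_simps)
  have "2 * int (card (cells (2 * r))) \<le> 2 * (\<Sum>d\<in>{1..<int r}. int (r choose 2) - d - int r + 2)
     + (2 * int (r choose 2) - 2 * int N + 2 * int N * int (r choose 2))"
    using * by (simp add: N algebra_simps)
  also have "\<dots> = (2 * int N + 1) * (2 * int (r choose 2)) - 2 * int N * int N + int N - int N * (int N + 1) - int N"
    unfolding s by (simp add: algebra_simps)
  also have "\<dots> = 2 * int N ^ 3"
    unfolding c by (simp add: algebra_simps power3_eq_cube)
  finally have "int (card (cells (2 * r))) \<le> int (N ^ 3)" by simp
  then show ?thesis unfolding N by simp
qed

text \<open>For \<open>d \<le> r\<close> the window has \<open>r + 1\<close> elements, among them
  \<open>0\<close> and \<open>d\<close>; for larger \<open>d\<close> it has only \<open>r\<close>,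
  and all of its pairs are allowed in the estimate.\<close>

lemma card_cells_odd: "2 * int (card (cells (Suc (2 * r)))) \<le> int r * (int r - 1) * (2 * int r - 1)"
proof -
  let ?m = "Suc (2 * r)"
  have small: "int (card (cell_pairs ?m d)) \<le> int (Suc r choose 2) - d - int r + 1" if d: "0 < d" "d \<le> int r" for d
  proof -
    define L where "L = - ((int r - d) div 2)"
    have "- (2 * L) \<le> int r - d" "int r - d \<le> - (2 * L) + 1" unfolding L_def by linarith+
    then have L: "L \<le> 0" "d < L + int (r + 1)" using d by linarith+
    have "nat (L + int (r + 1) - L) = Suc r" by simp
    then show ?thesis
      using card_pairs_avoiding_both[OF L(1) d(1) L(2)] d L
      unfolding cell_pairs_def window_odd_small[OF refl d(2)] L_def[symmetric] by simp
  qed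
  have large: "int (card (cell_pairs ?m d)) \<le> int (r choose 2)" if "int r < d" for d
    unfolding cell_pairs_def window_odd_large[OF refl that]
    by (rule order_trans[OF of_nat_mono[OF card_pairs_avoiding_le]]) simp
  have "int (card (cells ?m)) = (\<Sum>d\<in>{1..<int ?m}. int (card (cell_pairs ?m d)))"
    by (simp add: cells_def card_SigmaI finite_cell_pairs)
  also have "{1..<int ?m} = {1..<1 + int r} \<union> {1 + int r..<1 + 2 * int r}" by auto
  also have "(\<Sum>d\<in>\<dots>. int (card (cell_pairs ?m d))) =
     (\<Sum>d\<in>{1..<1 + int r}. int (card (cell_pairs ?m d)))
     + (\<Sum>d\<in>{1 + int r..<1 + 2 * int r}. int (card (cell_pairs ?m d)))"
    by (rule sum.union_disjoint) auto
  also have "\<dots> \<le> (\<Sum>d\<in>{1..<1 + int r}. int (Suc r choose 2) - d - int r + 1)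
     + (\<Sum>d\<in>{1 + int r..<1 + 2 * int r}. int (r choose 2))"
    by (intro add_mono sum_mono small large) auto
  finally have *: "int (card (cells ?m)) \<le> (\<Sum>d\<in>{1..<1 + int r}. int (Suc r choose 2) - d - int r + 1)
     + int r * int (r choose 2)" by simp
  have s: "2 * (\<Sum>d\<in>{1..<1 + int r}. int (Suc r choose 2) - d - int r + 1)
    = 2 * int r * (int (Suc r choose 2) - int r + 1) - int r * (int r + 1)"
    using sum_int_linear[of "int (Suc r choose 2) - int r + 1" r] by (simp add: algebra_simps)
  have "2 * int (card (cells ?m)) \<le> 2 * (\<Sum>d\<in>{1..<1 + int r}. int (Suc r choose 2) - d - int r + 1)
     + int r * (2 * int (r choose 2))"
    using * by (simp add: algebra_simps)
  also have "\<dots> = int r * (2 * int (Suc r choose 2)) - 2 * int r * int r + 2 * int r - int r * (int r + 1) + int r * (2 * int (r choose 2))"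
    unfolding s by (simp add: algebra_simps)
  also have "\<dots> = int r * (int r - 1) * (2 * int r - 1)"
    unfolding int_choose_two by (simp add: algebra_simps)
  finally show ?thesis .
qed

subsection \<open>Spirals in an annulus\<close>

text \<open>An ordered pair leads from an index in one layer to an index in the next, so all edge
  layers share the same labels.\<close>

definition links :: "nat \<Rightarrow> (nat \<times> nat) set" where
  "links m = {(a, b). a < m \<and> b < m \<and> a \<noteq> b}"

text \<open>The parameters stay strictly inside the unit interval, so that meetings at shared end
  points of arcs are not counted.\<close>

definition layer_crossings ::
  "nat \<Rightarrow> (nat \<times> nat \<Rightarrow> real \<Rightarrow> complex) \<Rightarrow> ((nat \<times> nat) set \<times> complex) set" where
  "layer_crossings m F = {({x, y}, F x s) | x y s t. x \<in> links m \<and> y \<in> links m \<and> x \<noteq> y \<and>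
     0 < s \<and> s < 1 \<and> 0 < t \<and> t < 1 \<and> F x s = F y t}"

lemma layer_crossingsI:
  assumes "x \<in> links m" "y \<in> links m" "x \<noteq> y" "0 < s" "s < 1" "0 < t" "t < 1" "F x s = F y t"
  shows "({x, y}, F x s) \<in> layer_crossings m F"
  unfolding layer_crossings_def using assms by blast

definition turn :: "nat \<Rightarrow> nat \<times> nat \<Rightarrow> int" where
  "turn m x = (int (snd x) - int (fst x)) mod int m"

text \<open>The radius \<open>exp t\<close> leads from the unit circle to the circle of radius
  \<open>exp 1\<close> and makes the parameter recoverable from the norm.\<close>

definition spiral :: "nat \<Rightarrow> nat \<times> nat \<Rightarrow> real \<Rightarrow> complex" where
  "spiral m x t = of_real (exp t) * cis (2 * pi * (real (fst x) + t * real_of_int (turn m x)) / real m)"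

lemma cis_eq_cis_iff: "cis a = cis b \<longleftrightarrow> (\<exists>n::int. a = b + 2 * pi * of_int n)"
  using sin_cos_eq_iff[of a b] by (auto simp: complex_eq_iff)

lemma mod_diff_mult: "(x - m * q) mod m = x mod m" for x :: int
  by (simp add: mod_eq_dvd_iff)

lemma links_turn:
  assumes "(a, b) \<in> links m"
  shows "1 \<le> turn m (a, b)" "turn m (a, b) < int m" "b = nat ((int a + turn m (a, b)) mod int m)"
proof -
  have m: "a < m" "b < m" "a \<noteq> b" using assms by (auto simp: links_def)
  have "turn m (a, b) \<noteq> 0"
  proof
    assume "turn m (a, b) = 0"
    then have "int b mod int m = int a mod int m"
      by (simp add: turn_def mod_eq_dvd_iff mod_eq_0_iff_dvd)
    with m show False by simp
  qed
  moreover have "0 \<le> turn m (a, b)" "turn m (a, b) < int m"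
    using m by (simp_all add: turn_def)
  ultimately show "1 \<le> turn m (a, b)" "turn m (a, b) < int m"
    by linarith+
  show "b = nat ((int a + turn m (a, b)) mod int m)"
    using m by (simp add: turn_def mod_simps)
qed

text \<open>Decodes a crossing: \<open>x + 1\<close> and \<open>z + 1\<close> are the turns of the
  slower and the faster spiral, and the faster one starts \<open>y - x\<close> steps behind. The
  shift by one moves the possible turns to \<open>0\<close>, ..., \<open>m - 2\<close>.\<close>

definition spiral_crossing :: "nat \<Rightarrow> nat \<times> nat \<times> nat \<times> nat \<Rightarrow> (nat \<times> nat) set \<times> complex" where
  "spiral_crossing m = (\<lambda>(a', x, y, z).
     let a = nat ((int a' - (int y - int x)) mod int m);
         b = nat ((int a + int z + 1) mod int m);
         b' = nat ((int a' + int x + 1) mod int m)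
     in ({(a, b), (a', b')}, spiral m (a', b') ((real y - real x) / (real z - real x))))"

text \<open>The angles agree up to full turns, so \<open>t * (K - K')\<close> is an integer
  \<open>r\<close> congruent to \<open>a' - a\<close> modulo \<open>m\<close>. As \<open>t\<close>
  is strictly between \<open>0\<close> and \<open>1\<close>, this integer is strictly between
  \<open>0\<close> and \<open>K - K'\<close>.\<close>

lemma spiral_meet:
  assumes x: "(a, b) \<in> links m" and y: "(a', b') \<in> links m"
    and lt: "turn m (a', b') < turn m (a, b)"
    and t: "0 < t" "t < 1" and eq: "spiral m (a, b) t = spiral m (a', b') t"
  shows "({(a, b), (a', b')}, spiral m (a', b') t) \<in>
    spiral_crossing m ` ({..<m} \<times> {(x, y, z). x < y \<and> y < z \<and> z < m - 1})"
proof -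
  define K K' where "K = turn m (a, b)" and "K' = turn m (a', b')"
  note K = links_turn[OF x, folded K_def] and K' = links_turn[OF y, folded K'_def]
  have m: "0 < m" "a < m" "a' < m" using x y by (auto simp: links_def)
  have lt': "K' < K" using lt by (simp add: K_def K'_def)
  from eq obtain N :: int where
    "2 * pi * (real a + t * K) / real m = 2 * pi * (real a' + t * K') / real m + 2 * pi * N"
    by (auto simp: spiral_def cis_eq_cis_iff K_def K'_def)
  then have "2 * pi * (real a + t * K) = 2 * pi * (real a' + t * K' + real m * N)"
    using m by (simp add: field_simps)
  then have "real a + t * K = real a' + t * K' + real m * N"
    by (simp only: mult_cancel_left) simp
  then have tr: "t * (K - K') = real_of_int (int a' - int a + int m * N)"
    by (simp add: algebra_simps)
  define r where "r = int a' - int a + int m * N"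
  have pos: "0 < real_of_int (K - K')" using lt' by simp
  have "0 < t * (K - K')" "t * (K - K') < 1 * real_of_int (K - K')"
    using t pos by (simp_all only: mult_pos_pos mult_strict_right_mono)
  then have "0 < real_of_int r" "real_of_int r < real_of_int (K - K')"
    unfolding tr r_def[symmetric] by simp_all
  then have r: "0 < r" "r < K - K'" by linarith+
  have a: "a = nat ((int a' - r) mod int m)"
    using m by (simp add: r_def mod_diff_mult)
  show ?thesis
  proof (rule image_eqI)
    show "(a', nat (K' - 1), nat (K' - 1 + r), nat (K - 1)) \<in> {..<m} \<times> {(x, y, z). x < y \<and> y < z \<and> z < m - 1}"
      using r K(1,2) K'(1,2) m by auto
    have "real_of_int r / (real_of_int K - real_of_int K') = t"
      using tr lt' by (simp add: r_def field_simps)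
    then show "({(a, b), (a', b')}, spiral m (a', b') t) =
        spiral_crossing m (a', nat (K' - 1), nat (K' - 1 + r), nat (K - 1))"
      using r K K' a by (simp add: spiral_crossing_def Let_def add.commute)
  qed
qed

text \<open>Spirals with the same turn are rotations of each other and keep a constant angular
  distance.\<close>

lemma spiral_inj:
  assumes x: "(a, b) \<in> links m" and y: "(a', b') \<in> links m"
    and same: "turn m (a, b) = turn m (a', b')" and eq: "spiral m (a, b) t = spiral m (a', b') t"
  shows "(a, b) = (a', b')"
proof -
  have m: "0 < m" "a < m" "a' < m" using x y by (auto simp: links_def)
  from eq same obtain N :: int where
    "2 * pi * (real a + t * turn m (a, b)) / real m = 2 * pi * (real a' + t * turn m (a, b)) / real m + 2 * pi * N"
    by (auto simp: spiral_def cis_eq_cis_iff)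
  then have "2 * pi * (real a + t * turn m (a, b)) = 2 * pi * (real a' + t * turn m (a, b) + real m * N)"
    using m by (simp add: field_simps)
  then have "real a + t * turn m (a, b) = real a' + t * turn m (a, b) + real m * N"
    by (simp only: mult_cancel_left) simp
  then have "real_of_int (int a) = real_of_int (int a' + int m * N)" by simp
  then have "int a = int a' + int m * N" by linarith
  then have "int a mod int m = int a' mod int m" by simp
  then have "a = a'" using m by simp
  then show ?thesis using links_turn(3)[OF x] links_turn(3)[OF y] same by simp
qed

lemma spiral_time:
  assumes "spiral m x s = spiral m y t"
  shows "s = t"
proof -
  have "norm (spiral m x s) = norm (spiral m y t)" using assms by simp
  then show ?thesis by (simp add: spiral_def norm_mult)
qed

lemma layer_crossings_spiral:
  "finite (layer_crossings m (spiral m)) \<and> card (layer_crossings m (spiral m)) \<le> m * ((m - 1) choose 3)"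
proof -
  let ?T = "{(x, y, z). x < y \<and> y < z \<and> z < m - 1}"
  have fin: "finite ?T" by (rule finite_subset[of _ "{..m} \<times> {..m} \<times> {..m}"]) auto
  have "layer_crossings m (spiral m) \<subseteq> spiral_crossing m ` ({..<m} \<times> ?T)"
  proof
    fix c assume "c \<in> layer_crossings m (spiral m)"
    then obtain a b a' b' s t where c: "c = ({(a, b), (a', b')}, spiral m (a, b) s)"
      and l: "(a, b) \<in> links m" "(a', b') \<in> links m" and ne: "(a, b) \<noteq> (a', b')"
      and st: "0 < s" "s < 1" and eq: "spiral m (a, b) s = spiral m (a', b') t"
      by (auto simp: layer_crossings_def)
    from spiral_time[OF eq] have t: "t = s" by simp
    note eq = eq[unfolded t]
    consider "turn m (a', b') < turn m (a, b)" | "turn m (a, b) < turn m (a', b')"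
      using spiral_inj[OF l _ eq] ne by linarith
    then show "c \<in> spiral_crossing m ` ({..<m} \<times> ?T)"
    proof cases
      case 1
      from spiral_meet[OF l this st eq] show ?thesis unfolding c eq .
    next
      case 2
      from spiral_meet[OF l(2,1) this st eq[symmetric]] show ?thesis unfolding c insert_commute[of "(a, b)"] .
    qed
  qed
  moreover have "card (spiral_crossing m ` ({..<m} \<times> ?T)) \<le> m * ((m - 1) choose 3)"
    using card_image_le[of "{..<m} \<times> ?T" "spiral_crossing m"] fin
    by (simp add: card_cartesian_product card_nat_triples)
  ultimately show ?thesis
    using fin by (meson card_mono finite_SigmaI finite_imageI finite_lessThan finite_subset order_trans)
qed

subsection \<open>Segments from a small central circle\<close>

text \<open>The determinant of two plane vectors, positive when \<open>v\<close> points to the left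
  of \<open>u\<close>.\<close>

definition wedge :: "complex \<Rightarrow> complex \<Rightarrow> real" where
  "wedge u v = Re u * Im v - Im u * Re v"

lemma wedge_simps:
  "wedge (u + v) w = wedge u w + wedge v w" "wedge (u - v) w = wedge u w - wedge v w"
  "wedge w (u + v) = wedge w u + wedge w v" "wedge w (u - v) = wedge w u - wedge w v"
  "wedge (c *\<^sub>R u) v = c * wedge u v" "wedge u (c *\<^sub>R v) = c * wedge u v" "wedge u u = 0"
  by (simp_all add: wedge_def algebra_simps)

lemma wedge_commute: "wedge u v = - wedge v u"
  by (simp add: wedge_def)

lemma wedge_cis: "wedge (cis a) (cis b) = sin (b - a)"
  by (simp add: wedge_def sin_diff)

definition rim :: "nat \<Rightarrow> int \<Rightarrow> complex" where
  "rim m k = cis (2 * pi * real_of_int k / real m)"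

text \<open>
  The central point \<open>i\<close> is almost opposite to the rim point \<open>i\<close>, to which it is not joined. For even \<open>m\<close> the
  deviation by \<open>pi / (2 * m)\<close> puts the lines through two central points in general position with respect to the rim;
  for odd \<open>m\<close> it makes each of them parallel to the direction of some rim point, which saves further crossings.
\<close>

definition centre :: "nat \<Rightarrow> int \<Rightarrow> complex" where
  "centre m i = cis (pi * (2 * real_of_int i - 2 * real (m div 2) - 1 / 2) / real m)"

lemma norm_rim [simp]: "norm (rim m k) = 1" by (simp add: rim_def)
lemma norm_centre [simp]: "norm (centre m k) = 1" by (simp add: centre_def)

lemma centre_nonzero [simp]: "centre m k \<noteq> 0" by (simp add: centre_def)

lemma rim_eq_iff: "0 < m \<Longrightarrow> rim m k = rim m l \<longleftrightarrow> k mod int m = l mod int m"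
proof -
  assume m: "0 < m"
  have "rim m k = rim m l \<longleftrightarrow> (\<exists>N::int. 2 * pi * real_of_int k / real m = 2 * pi * real_of_int l / real m + 2 * pi * N)"
    unfolding rim_def cis_eq_cis_iff ..
  also have "\<dots> \<longleftrightarrow> (\<exists>N::int. real_of_int k = real_of_int (l + int m * N))"
  proof (rule ex_cong1)
    fix N :: int
    have "2 * pi * real_of_int k / real m = 2 * pi * real_of_int l / real m + 2 * pi * N
      \<longleftrightarrow> (2 * pi) * real_of_int k = (2 * pi) * real_of_int (l + int m * N)"
      using m by (simp add: field_simps)
    also have "\<dots> \<longleftrightarrow> real_of_int k = real_of_int (l + int m * N)"
      by (subst mult_cancel_left) simp
    finally show "2 * pi * real_of_int k / real m = 2 * pi * real_of_int l / real m + 2 * pi * N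
      \<longleftrightarrow> real_of_int k = real_of_int (l + int m * N)" .
  qed
  also have "\<dots> \<longleftrightarrow> (\<exists>N::int. k = l + int m * N)" by (simp only: of_int_eq_iff)
  also have "\<dots> \<longleftrightarrow> k mod int m = l mod int m"
    by (metis mod_eqE mod_mult_self2)
  finally show ?thesis .
qed

lemma centre_rim: "0 < m \<Longrightarrow> centre m i = rim m i * cis (- pi * (2 * real (m div 2) + 1 / 2) / real m)"
  by (simp add: centre_def rim_def cis_mult field_simps)

lemma centre_eq_iff: "0 < m \<Longrightarrow> centre m k = centre m l \<longleftrightarrow> k mod int m = l mod int m"
  by (simp add: centre_rim rim_eq_iff)

lemma wedge_rim: "0 < m \<Longrightarrow> wedge (rim m k) (rim m l) = sin (2 * pi * real_of_int (l - k) / real m)"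
  by (simp add: rim_def wedge_cis diff_divide_distrib algebra_simps)

lemma wedge_centre: "0 < m \<Longrightarrow> wedge (centre m k) (centre m l) = sin (2 * pi * real_of_int (l - k) / real m)"
  unfolding centre_def wedge_cis by (rule arg_cong[of _ _ sin]) (simp add: field_simps)

section \<open>Rim points relative to the lines through two central points\<close>

definition side :: "nat \<Rightarrow> int \<Rightarrow> int \<Rightarrow> int \<Rightarrow> real" where
  "side m i j k = wedge (centre m j - centre m i) (rim m k)"

text \<open>The angle, in units of \<open>pi / m\<close>, from the direction of the line from
  central point \<open>i\<close> to \<open>i + d\<close> to the direction of rim point
  \<open>i + k\<close>; it matters only modulo \<open>2 * m\<close>.\<close>

definition gap :: "nat \<Rightarrow> int \<Rightarrow> int \<Rightarrow> real" where
  "gap m d k = 2 * k - d + 2 * real (m div 2) + 1 / 2 - real m / 2"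

lemma gap_even: "gap (2 * r) d k = real_of_int (2 * k - d + int r) + 1 / 2"
  by (simp add: gap_def)

lemma gap_odd: "gap (Suc (2 * r)) d k = real_of_int (2 * k - d + int r)"
  by (simp add: gap_def field_simps)

text \<open>The sum-to-product formula splits the determinant into the distance of the two central
  points and the sine of the angle to the rim direction. For \<open>0 < d < m\<close> the first
  factor is positive, so the second decides the sign.\<close>

lemma side_eq:
  assumes "0 < m"
  shows "side m i (i + d) (i + k) = 2 * sin (pi * d / m) * sin (pi * gap m d k / m)"
proof -
  let ?c = "2 * real (m div 2) + 1 / 2"
  define w z where "w = 2 * pi * real_of_int (i + k) / m - pi * (2 * real_of_int (i + d) - 2 * real (m div 2) - 1 / 2) / m"
    and "z = 2 * pi * real_of_int (i + k) / m - pi * (2 * real_of_int i - 2 * real (m div 2) - 1 / 2) / m"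
  have "side m i (i + d) (i + k) = sin w - sin z"
    by (simp add: side_def wedge_simps centre_def rim_def wedge_cis w_def z_def)
  also have "\<dots> = 2 * sin ((w - z) / 2) * cos ((w + z) / 2)" by (rule sin_diff_sin)
  also have "(w - z) / 2 = - (pi * d / m)"
    unfolding w_def z_def using assms by (simp add: field_simps)
  also have "(w + z) / 2 = pi * gap m d k / m + pi / 2"
    unfolding w_def z_def gap_def using assms by (simp add: field_simps)
  also have "cos \<dots> = - sin (pi * gap m d k / m)" by (simp add: cos_add)
  finally show ?thesis by simp
qed

text \<open>
  The position of rim point \<open>k\<close> with respect to the line through the points \<open>e * centre m i\<close> and
  \<open>e * centre m j\<close> for all small \<open>e > 0\<close>: if the line is parallel to the direction of the rim point, then
  the side on which the origin lies decides.
\<close>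

definition left_of :: "nat \<Rightarrow> int \<Rightarrow> int \<Rightarrow> int \<Rightarrow> bool" where
  "left_of m i j k \<longleftrightarrow> side m i j k > 0 \<or> side m i j k = 0 \<and> wedge (centre m i) (centre m j) > 0"

lemma sin_step_pos: "1 \<le> d \<Longrightarrow> d < int m \<Longrightarrow> 0 < sin (pi * real_of_int d / real m)"
  by (rule sin_gt_zero) (auto simp: field_simps)

text \<open>Shifting \<open>k\<close> by multiples of \<open>m\<close> brings the gap into
  \<open>[0, 2 * m)\<close>, and a nonnegative sine then leaves \<open>[0, m]\<close>. Rewritten for
  each parity of \<open>m\<close>, this is the window.\<close>

lemma left_of_window:
  assumes d: "1 \<le> d" "d < int m" and left: "left_of m i (i + d) (i + k)"
  obtains k' where "k' \<in> window m d" "k' mod int m = k mod int m"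
proof
  have m: "0 < m" using d by simp
  define q where "q = \<lfloor>gap m d k / (2 * m)\<rfloor>"
  define k' where "k' = k - int m * q"
  define g where "g = gap m d k'"
  show "k' mod int m = k mod int m" unfolding k'_def by (rule mod_diff_mult)
  have gq: "g = gap m d k - 2 * m * q" by (simp add: g_def gap_def k'_def algebra_simps)
  then have "g = gap m d k - 2 * m * q" .
  moreover have "of_int q \<le> gap m d k / (2 * m)" "gap m d k / (2 * m) < of_int q + 1"
    unfolding q_def by linarith+
  ultimately have g: "0 \<le> g" "g < 2 * m" using m by (simp_all add: field_simps)
  have "pi * gap m d k / m = pi * g / m + 2 * pi * q"
    using m by (simp add: gq field_simps)
  then have sg: "sin (pi * gap m d k / m) = sin (pi * g / m)"
    using sin_cos_eq_iff[of "pi * gap m d k / m" "pi * g / m"] by auto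
  have pos: "0 < sin (pi * d / m)" by (rule sin_step_pos[OF d])
  have wc: "wedge (centre m i) (centre m (i + d)) = sin (2 * pi * d / m)"
    using wedge_centre[OF m, of i "i + d"] by simp
  have ge: "0 \<le> sin (pi * g / m)" and eq0: "sin (pi * g / m) = 0 \<Longrightarrow> 0 < sin (2 * pi * d / m)"
    using left pos unfolding left_of_def side_eq[OF m] sg wc by (auto simp: zero_less_mult_iff)
  have gm: "g \<le> m"
  proof (rule ccontr)
    assume "\<not> g \<le> m"
    then have "sin (pi * g / m) < 0" using g(2) m by (intro sin_lt_zero) (auto simp: field_simps)
    with ge show False by simp
  qed
  show "k' \<in> window m d"
  proof (cases "even m")
    case True
    then obtain r where r: "m = 2 * r" by blast
    have "0 \<le> real_of_int (2 * k' - d + int r) + 1 / 2" "real_of_int (2 * k' - d + int r) + 1 / 2 \<le> 2 * r"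
      using g(1) gm unfolding g_def r gap_even by simp_all
    then have "0 \<le> 2 * k' - d + int r" "2 * k' - d + int r < 2 * int r" by linarith+
    then show ?thesis unfolding window_def Let_def r by simp
  next
    case False
    then obtain r where r: "m = Suc (2 * r)" using oddE by fastforce
    have "0 \<le> real_of_int (2 * k' - d + int r)" "real_of_int (2 * k' - d + int r) \<le> real (2 * r + 1)"
      using g(1) gm unfolding g_def r gap_odd by simp_all
    then have b: "0 \<le> 2 * k' - d + int r" "2 * k' - d + int r \<le> 2 * int r + 1" by linarith+
    \<comment> \<open>The gap values \<open>0\<close> and \<open>m\<close> are the parallel cases.
      For \<open>m < 2 * d < 2 * m\<close> the determinant of the two central points is negative,
      which rules these cases out.\<close>
    have strict: "2 * k' - d + int r \<noteq> 0" "2 * k' - d + int r \<noteq> 2 * int r + 1" if "int r < d"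
    proof -
      have "real m < real_of_int (2 * d)" "real_of_int (2 * d) < 2 * real m"
        using d that r by linarith+
      then have "sin (pi * real_of_int (2 * d) / m) < 0"
        using m by (intro sin_lt_zero) (simp_all only: pos_less_divide_eq pos_divide_less_eq of_nat_0_less_iff mult_less_cancel_left_pos pi_gt_zero mult.assoc mult.left_commute[of 2 pi])
      then have "sin (2 * pi * d / m) < 0" by (simp add: algebra_simps)
      then have "sin (pi * g / m) \<noteq> 0" using eq0 by force
      then have "g \<noteq> 0" "g \<noteq> m" using m by auto
      then show "2 * k' - d + int r \<noteq> 0" "2 * k' - d + int r \<noteq> 2 * int r + 1"
        unfolding g_def r gap_odd by auto
    qed
    have "odd m" "m div 2 = r" using r by auto
    then show ?thesis using b strict unfolding window_def Let_def by auto
  qed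
qed

text \<open>A window spans less than half a turn, so the sine has the sign of
  \<open>l - k\<close>.\<close>

lemma window_order:
  assumes "k \<in> window m d" "l \<in> window m d" "k \<noteq> l" "0 \<le> sin (2 * pi * real_of_int (l - k) / m)"
  shows "k < l"
proof (rule ccontr)
  assume "\<not> k < l"
  then have lk: "l < k" using assms by simp
  have w: "2 * (k - l) < int m"
  proof (cases "even m")
    case True
    then obtain r where r: "m = 2 * r" by blast
    then show ?thesis using assms(1,2) unfolding window_def Let_def by auto
  next
    case False
    then obtain r where r: "m = Suc (2 * r)" using oddE by fastforce
    then have "odd m" "m div 2 = r" by auto
    then have "2 * (k - l) \<le> 2 * int r + 1"
      using assms(1,2) unfolding window_def Let_def by (auto split: if_splits)
    \<comment> \<open>The left side is even and \<open>m\<close> is odd, which makes the inequality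
      strict.\<close>
    then show ?thesis unfolding r by presburger
  qed
  then have "real_of_int (2 * (k - l)) / real m < 1" using lk by simp
  then have "pi * (real_of_int (2 * (k - l)) / real m) < pi * 1"
    by (rule mult_strict_left_mono) simp
  then have "0 < sin (2 * pi * real_of_int (k - l) / m)"
    using lk w by (intro sin_gt_zero) (auto simp: mult.assoc mult.left_commute)
  moreover have "2 * pi * real_of_int (l - k) / m = - (2 * pi * real_of_int (k - l) / m)"
    by (simp add: diff_divide_distrib algebra_simps)
  ultimately show False using assms(4) by simp
qed

text \<open>This guarantees that the first-order term decides when the leading one vanishes. For
  even \<open>m\<close> the gap is a half-integer and no multiple of \<open>m\<close>; for odd
  \<open>m\<close> a zero determinant gives that \<open>m\<close> divides \<open>2 * d\<close>,
  hence \<open>d\<close>.\<close>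

lemma side_generic:
  assumes "1 \<le> d" "d < int m" "side m i (i + d) (i + k) = 0"
  shows "wedge (centre m i) (centre m (i + d)) \<noteq> 0"
proof
  assume 0: "wedge (centre m i) (centre m (i + d)) = 0"
  have m: "0 < m" using assms by simp
  have int: "\<exists>N::int. x = m * N" if "sin (pi * x / m) = 0" for x :: real
    using that m unfolding sin_zero_iff_int2 by (auto simp: field_simps)
  from 0 have "sin (pi * (2 * d) / m) = 0"
    using wedge_centre[OF m, of i "i + d"] by (simp add: algebra_simps)
  from int[OF this] obtain N :: int where "real_of_int (2 * d) = real_of_int (m * N)" by auto
  then have N: "2 * d = m * N" by linarith
  have "sin (pi * gap m d k / m) = 0"
    using assms(3) sin_step_pos[OF assms(1,2)] unfolding side_eq[OF m] by simp
  from int[OF this] obtain M :: int where M: "gap m d k = real_of_int (m * M)" by auto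
  show False
  proof (cases "even m")
    case True
    then obtain r where r: "m = 2 * r" by blast
    have "real_of_int (2 * (2 * k - d + int r) + 1) = real_of_int (2 * (m * M))"
      using M unfolding r gap_even by simp
    then have "2 * (2 * k - d + int r) + 1 = 2 * (m * M)" by linarith
    then show False by presburger
  next
    case False
    then have "even N" using N by (metis dvd_triv_left even_mult_iff even_of_nat)
    then obtain N' where "N = 2 * N'" by blast
    then have "d = m * N'" using N by simp
    then show False using assms(1,2) by (metis dvd_triv_left zdvd_not_zless zero_less_one order_less_le_trans)
  qed
qed

section \<open>The segments, a suitable radius of the central circle, and the crossings\<close>

definition chord :: "nat \<Rightarrow> real \<Rightarrow> nat \<times> nat \<Rightarrow> real \<Rightarrow> complex" where
  "chord m e x = linepath (e *\<^sub>R centre m (int (fst x))) (rim m (int (snd x)))"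

text \<open>This makes "tiny" precise: no rim point is collinear with two central points, and
  positive signs at radius \<open>e\<close> agree with the limiting configuration.\<close>

definition good_radius :: "nat \<Rightarrow> real \<Rightarrow> bool" where
  "good_radius m e \<longleftrightarrow> 0 < e \<and> e < 1 \<and>
    (\<forall>a\<in>{..<m}. \<forall>a'\<in>{..<m}. \<forall>b\<in>{..<m}. a \<noteq> a' \<longrightarrow>
       (let w = wedge (centre m (int a') - centre m (int a)) (rim m (int b) - e *\<^sub>R centre m (int a))
        in w \<noteq> 0 \<and> (w > 0 \<longrightarrow> left_of m (int a) (int a') (int b)))) \<and>
    (\<forall>a\<in>{..<m}. \<forall>a'\<in>{..<m}. \<forall>b\<in>{..<m}. \<forall>b'\<in>{..<m}.
       wedge (rim m (int b) - e *\<^sub>R centre m (int a)) (rim m (int b') - e *\<^sub>R centre m (int a')) > 0 \<longrightarrow>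
       wedge (rim m (int b)) (rim m (int b')) \<ge> 0)"

lemma eventually_sign:
  fixes D T :: real
  assumes "D = 0 \<Longrightarrow> T \<noteq> 0"
  shows "\<forall>\<^sub>F e in at_right 0. D + e * T \<noteq> 0 \<and> (D + e * T > 0 \<longrightarrow> D > 0 \<or> D = 0 \<and> T > 0)"
proof (cases "D = 0")
  case True
  have "\<forall>\<^sub>F e in at_right 0. e > (0::real)" by (rule eventually_at_right_less)
  then show ?thesis by eventually_elim (use True assms in \<open>auto simp: zero_less_mult_iff\<close>)
next
  case False
  have lim: "((\<lambda>e. D + e * T) \<longlongrightarrow> D) (at_right 0)"
    by (auto intro!: tendsto_eq_intros)
  show ?thesis
  proof (cases "D > 0")
    case True
    from order_tendstoD(1)[OF lim True] show ?thesis by eventually_elim (use True in auto)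
  next
    case F: False
    then have "D < 0" using False by simp
    from order_tendstoD(2)[OF lim this] show ?thesis by eventually_elim auto
  qed
qed

lemma left_of_cong:
  assumes "0 < m" "j mod int m = j' mod int m" "k mod int m = k' mod int m"
  shows "left_of m i j k \<longleftrightarrow> left_of m i j' k'"
  using assms centre_eq_iff[of m j j'] rim_eq_iff[of m k k'] by (simp add: left_of_def side_def)

text \<open>Finitely many conditions, each of which holds eventually as \<open>e\<close> tends to
  \<open>0\<close> from the right.\<close>

lemma good_radius_ex: "\<exists>e. good_radius m e"
proof -
  have 1: "\<forall>\<^sub>F e in at_right 0. a \<noteq> a' \<longrightarrow>
       (let w = wedge (centre m (int a') - centre m (int a)) (rim m (int b) - e *\<^sub>R centre m (int a))
        in w \<noteq> 0 \<and> (w > 0 \<longrightarrow> left_of m (int a) (int a') (int b)))" (is "?E a a' b")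
    if "a < m" "a' < m" "b < m" for a a' b
  proof (cases "a = a'")
    case False
    let ?d = "turn m (a, a')"
    have m: "0 < m" using that by simp
    have l: "(a, a') \<in> links m" using False that by (simp add: links_def)
    note d = links_turn(1,2)[OF l]
    have c: "centre m (int a') = centre m (int a + ?d)"
      unfolding centre_eq_iff[OF m] by (simp add: turn_def mod_simps)
    let ?D = "side m (int a) (int a') (int b)" and ?T = "wedge (centre m (int a)) (centre m (int a'))"
    have "?D = 0 \<Longrightarrow> ?T \<noteq> 0"
      using side_generic[OF d, of "int a" "int b - int a"] unfolding side_def c by simp
    from eventually_sign[OF this] have "\<forall>\<^sub>F e in at_right 0. ?D + e * ?T \<noteq> 0 \<and>
      (?D + e * ?T > 0 \<longrightarrow> left_of m (int a) (int a') (int b))" by (simp add: left_of_def)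
    then show ?thesis
    proof eventually_elim
      case (elim e)
      \<comment> \<open>By bilinearity the determinant is affine in \<open>e\<close>: its constant
        term is the side, its slope the determinant of the two central points.\<close>
      have "wedge (centre m (int a') - centre m (int a)) (rim m (int b) - e *\<^sub>R centre m (int a)) = ?D + e * ?T"
        using wedge_commute[of "centre m (int a')" "centre m (int a)"] by (simp add: side_def wedge_simps algebra_simps)
      then show ?case using elim by simp
    qed
  qed simp
  have 2: "\<forall>\<^sub>F e in at_right 0.
       wedge (rim m (int b) - e *\<^sub>R centre m (int a)) (rim m (int b') - e *\<^sub>R centre m (int a')) > 0 \<longrightarrow>
       wedge (rim m (int b)) (rim m (int b')) \<ge> 0" for a a' b b'
  proof (cases "wedge (rim m (int b)) (rim m (int b')) \<ge> 0")
    case False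
    have "((\<lambda>e. wedge (rim m (int b) - e *\<^sub>R centre m (int a)) (rim m (int b') - e *\<^sub>R centre m (int a')))
      \<longlongrightarrow> wedge (rim m (int b)) (rim m (int b'))) (at_right 0)"
      unfolding wedge_def by (auto intro!: tendsto_eq_intros)
    from order_tendstoD(2)[OF this, of 0] False show ?thesis
      by (auto elim: eventually_mono)
  qed simp
  have "\<forall>\<^sub>F e in at_right 0. e < (1::real)"
    using eventually_at_right_field[of "\<lambda>e. e < 1" 0] by (auto intro: exI[of _ 1])
  then have "\<forall>\<^sub>F e in at_right 0. good_radius m e"
    unfolding good_radius_def
    by (intro eventually_conj eventually_at_right_less eventually_ball_finite ballI 1 2) auto
  then show ?thesis using eventually_happens' trivial_limit_at_right_real by blast
qed

lemma chord_eq: "chord m e (a, b) t = e *\<^sub>R centre m (int a) + t *\<^sub>R (rim m (int b) - e *\<^sub>R centre m (int a))"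
  by (simp add: chord_def linepath_def algebra_simps)

lemma norm_chord_lt:
  assumes "0 \<le> e" "e < 1" "0 \<le> t" "t < 1"
  shows "norm (chord m e x t) < 1"
proof -
  have "norm (chord m e x t) \<le> norm ((1 - t) *\<^sub>R (e *\<^sub>R centre m (int (fst x)))) + norm (t *\<^sub>R rim m (int (snd x)))"
    unfolding chord_def linepath_def by (rule norm_triangle_ineq)
  also have "\<dots> = (1 - t) * e + t" using assms by simp
  also have "\<dots> = 1 - (1 - t) * (1 - e)" by (simp add: algebra_simps)
  also have "\<dots> < 1" using assms by simp
  finally show ?thesis .
qed

text \<open>Such segments have the same direction, so if they differed in length, one would end
  inside the other. But interior points have norm below \<open>1\<close>, while the ends have norm
  \<open>1\<close>.\<close>

lemma chords_same_centre:
  assumes e: "0 \<le> e" "e < 1" and st: "0 < s" "s < 1" "0 < t" "t < 1"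
    and eq: "chord m e (a, b) s = chord m e (a, b') t"
  shows "rim m (int b) = rim m (int b')"
proof -
  have *: "rim m (int b) = rim m (int b')"
    if st: "0 < s" "s \<le> t" and eq: "chord m e (a, b) s = chord m e (a, b') t" for s t b b'
  proof -
    let ?X = "e *\<^sub>R centre m (int a)"
    have "t *\<^sub>R (rim m (int b') - ?X) = s *\<^sub>R (rim m (int b) - ?X)"
      using eq unfolding chord_eq by simp
    then have "inverse t *\<^sub>R (t *\<^sub>R (rim m (int b') - ?X)) = inverse t *\<^sub>R (s *\<^sub>R (rim m (int b) - ?X))"
      by simp
    then have "rim m (int b') - ?X = (s / t) *\<^sub>R (rim m (int b) - ?X)"
      using st by (simp add: divide_inverse mult.commute del: scaleR_right_diff_distrib)
    then have b': "rim m (int b') = chord m e (a, b) (s / t)"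
      unfolding chord_eq by (simp add: algebra_simps)
    have "\<not> s / t < 1"
      using norm_chord_lt[OF e, of "s / t" m "(a, b)"] st unfolding b'[symmetric] by force
    then have "s = t" using st by (simp add: not_less)
    then have "s / t = 1" using st by simp
    then show ?thesis using b' by (simp add: chord_eq)
  qed
  show ?thesis using *[OF st(1) _ eq] *[OF st(3) _ eq[symmetric]] by (cases "s \<le> t") auto
qed

text \<open>A common point means \<open>e *\<^sub>R d = s *\<^sub>R u - t *\<^sub>R v\<close>.
  Taking determinants with \<open>u\<close> and \<open>v\<close> gives \<open>t\<close> and
  \<open>s\<close> by Cramer's rule; since both are positive, \<open>wedge d u\<close> and
  \<open>wedge d v\<close> have the sign of \<open>wedge u v\<close>.\<close>

lemma chords_meet:
  assumes good: "good_radius m e" and x: "(a, b) \<in> links m" and y: "(a', b') \<in> links m"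
    and ne: "(a, b) \<noteq> (a', b')"
    and st: "0 < s" "s < 1" "0 < t" "t < 1" and eq: "chord m e (a, b) s = chord m e (a', b') t"
  defines "d \<equiv> centre m (int a') - centre m (int a)"
    and "u \<equiv> rim m (int b) - e *\<^sub>R centre m (int a)"
    and "v \<equiv> rim m (int b') - e *\<^sub>R centre m (int a')"
  shows "wedge u v \<noteq> 0" "a \<noteq> a'" "b \<noteq> b'" "s = e * wedge d v / wedge u v"
    "wedge u v > 0 \<Longrightarrow> left_of m (int a) (int a') (int b) \<and> left_of m (int a) (int a') (int b') \<and>
       wedge (rim m (int b)) (rim m (int b')) \<ge> 0"
proof -
  have m: "0 < m" "a < m" "a' < m" "b < m" "b' < m" using x y by (auto simp: links_def)
  have e: "0 < e" "e < 1" using good by (auto simp: good_radius_def)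
  show aa: "a \<noteq> a'"
  proof
    assume "a = a'"
    then have "rim m (int b) = rim m (int b')"
      using chords_same_centre[OF less_imp_le[OF e(1)] e(2) st] eq by simp
    then have "b = b'" using m by (simp add: rim_eq_iff)
    with ne \<open>a = a'\<close> show False by simp
  qed
  have d: "e *\<^sub>R d = s *\<^sub>R u - t *\<^sub>R v"
    using eq unfolding chord_eq d_def u_def v_def by (simp add: algebra_simps)
  have "wedge (e *\<^sub>R d) u = wedge (s *\<^sub>R u - t *\<^sub>R v) u" "wedge (e *\<^sub>R d) v = wedge (s *\<^sub>R u - t *\<^sub>R v) v"
    unfolding d by simp_all
  then have du: "e * wedge d u = t * wedge u v" and dv: "e * wedge d v = s * wedge u v"
    using wedge_commute[of v u] by (simp_all add: wedge_simps)
  \<comment> \<open>Changing the base point from \<open>a'\<close> to \<open>a\<close> alters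
    \<open>v\<close> by a multiple of \<open>d\<close>, which \<open>wedge d\<close>
    annihilates.\<close>
  have dv': "wedge d v = wedge d (rim m (int b') - e *\<^sub>R centre m (int a))"
    unfolding v_def d_def using wedge_commute[of "centre m (int a')" "centre m (int a)"]
    by (simp add: wedge_simps algebra_simps)
  have good': "wedge d (rim m (int c) - e *\<^sub>R centre m (int a)) \<noteq> 0"
    "wedge d (rim m (int c) - e *\<^sub>R centre m (int a)) > 0 \<Longrightarrow> left_of m (int a) (int a') (int c)"
    if "c < m" for c
    using good aa m that unfolding good_radius_def d_def Let_def by blast+
  have "wedge d u \<noteq> 0" using good'(1)[OF m(4)] unfolding u_def .
  then show uv: "wedge u v \<noteq> 0" using du e by auto
  show "s = e * wedge d v / wedge u v" using dv uv by simp
  show "b \<noteq> b'"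
  proof
    assume "b = b'"
    \<comment> \<open>A common rim point yields a second decomposition of the same vector, which
      would force \<open>s = 1\<close>.\<close>
    then have "e *\<^sub>R d = u - v" by (simp add: u_def v_def d_def algebra_simps)
    then have "s *\<^sub>R u - t *\<^sub>R v = u - v" using d by simp
    then have "wedge (s *\<^sub>R u - t *\<^sub>R v) v = wedge (u - v) v" by simp
    then show False using uv st by (simp add: wedge_simps)
  qed
  show "left_of m (int a) (int a') (int b) \<and> left_of m (int a) (int a') (int b') \<and>
       wedge (rim m (int b)) (rim m (int b')) \<ge> 0" if pos: "wedge u v > 0"
  proof (intro conjI)
    have "e * wedge d u > 0" "e * wedge d v > 0" unfolding du dv using pos st by simp_all
    then have "wedge d u > 0" "wedge d v > 0" using e by (simp_all add: zero_less_mult_iff)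
    then show "left_of m (int a) (int a') (int b)" "left_of m (int a) (int a') (int b')"
      using good'(2) m unfolding dv' u_def by simp_all
    show "wedge (rim m (int b)) (rim m (int b')) \<ge> 0"
      using good m pos unfolding good_radius_def u_def v_def by blast
  qed
qed

text \<open>The parameter is the one from Cramer's rule, so the crossing is a function of the first
  central point and the cell alone.\<close>

definition chord_crossing :: "nat \<Rightarrow> real \<Rightarrow> nat \<times> int \<times> int \<times> int \<Rightarrow> (nat \<times> nat) set \<times> complex" where
  "chord_crossing m e = (\<lambda>(a, d, k, l).
     let a' = nat ((int a + d) mod int m);
         b = nat ((int a + k) mod int m);
         b' = nat ((int a + l) mod int m);
         u = rim m (int b) - e *\<^sub>R centre m (int a);
         v = rim m (int b') - e *\<^sub>R centre m (int a')
     in ({(a, b), (a', b')},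
         chord m e (a, b) (e * wedge (centre m (int a') - centre m (int a)) v / wedge u v)))"

text \<open>Both rim points are to the left of the line, which gives representatives
  \<open>k\<close> and \<open>l\<close> in the window; the orientation of the rim points orders
  them. That \<open>b \<noteq> a\<close> and \<open>b' \<noteq> a'\<close> excludes
  \<open>k = 0\<close> and \<open>l = d\<close>.\<close>

lemma chords_meet_cell:
  assumes good: "good_radius m e" and x: "(a, b) \<in> links m" and y: "(a', b') \<in> links m"
    and ne: "(a, b) \<noteq> (a', b')"
    and st: "0 < s" "s < 1" "0 < t" "t < 1" and eq: "chord m e (a, b) s = chord m e (a', b') t"
    and pos: "wedge (rim m (int b) - e *\<^sub>R centre m (int a)) (rim m (int b') - e *\<^sub>R centre m (int a')) > 0"
  shows "({(a, b), (a', b')}, chord m e (a, b) s) \<in> chord_crossing m e ` ({..<m} \<times> cells m)"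
proof -
  have m: "0 < m" "a < m" "a' < m" "b < m" "b' < m" using x y by (auto simp: links_def)
  note meet = chords_meet[OF good x y ne st eq]
  define d where "d = turn m (a, a')"
  have "(a, a') \<in> links m" using meet(2) m by (simp add: links_def)
  note d = links_turn[OF this, folded d_def]
  have ad: "int a' mod int m = (int a + d) mod int m" by (simp add: d_def turn_def mod_simps)
  have cells: "left_of m (int a) (int a + d) (int a + (int c - int a))" if "left_of m (int a) (int a') (int c)" for c
    using that left_of_cong[OF m(1) ad refl] by simp
  have L: "left_of m (int a) (int a') (int b)" "left_of m (int a) (int a') (int b')"
    and W: "wedge (rim m (int b)) (rim m (int b')) \<ge> 0"
    using meet(5)[OF pos] by blast+
  obtain k where k: "k \<in> window m d" "k mod int m = (int b - int a) mod int m"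
    using left_of_window[OF d(1,2) cells[OF L(1)]] .
  obtain l where l: "l \<in> window m d" "l mod int m = (int b' - int a) mod int m"
    using left_of_window[OF d(1,2) cells[OF L(2)]] .
  have kb: "(int a + k) mod int m = int b" and lb: "(int a + l) mod int m = int b'"
    using k(2) l(2) m mod_add_cong[OF refl k(2), of "int a"] mod_add_cong[OF refl l(2), of "int a"] by simp_all
  have "rim m (int b) = rim m (int a + k)" "rim m (int b') = rim m (int a + l)"
    using kb lb m by (simp_all add: rim_eq_iff)
  then have "0 \<le> sin (2 * pi * real_of_int (l - k) / m)"
    using W wedge_rim[OF m(1), of "int a + k" "int a + l"] by simp
  moreover have "k \<noteq> l" using kb lb meet(3) by auto
  ultimately have "k < l" using window_order k(1) l(1) by blast
  moreover have "k \<noteq> 0" using kb m x by (auto simp: links_def)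
  moreover have "l \<noteq> d" using lb d(3) y by (auto simp: links_def)
  ultimately have "(d, k, l) \<in> cells m" using d k l by (simp add: cells_def cell_pairs_def)
  moreover have "(int a + d) mod int m = int a'" using ad m by simp
  then have "({(a, b), (a', b')}, chord m e (a, b) s) = chord_crossing m e (a, d, k, l)"
    using meet(4) by (simp add: chord_crossing_def Let_def kb lb)
  ultimately show ?thesis using m(2) by blast
qed

lemma layer_crossings_chord:
  assumes good: "good_radius m e"
  shows "finite (layer_crossings m (chord m e)) \<and> card (layer_crossings m (chord m e)) \<le> m * card (cells m)"
proof -
  have "layer_crossings m (chord m e) \<subseteq> chord_crossing m e ` ({..<m} \<times> cells m)"
  proof
    fix c assume "c \<in> layer_crossings m (chord m e)"
    then obtain a b a' b' s t where c: "c = ({(a, b), (a', b')}, chord m e (a, b) s)"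
      and l: "(a, b) \<in> links m" "(a', b') \<in> links m" and ne: "(a, b) \<noteq> (a', b')"
      and st: "0 < s" "s < 1" "0 < t" "t < 1" and eq: "chord m e (a, b) s = chord m e (a', b') t"
      by (auto simp: layer_crossings_def)
    let ?u = "rim m (int b) - e *\<^sub>R centre m (int a)" and ?v = "rim m (int b') - e *\<^sub>R centre m (int a')"
    \<comment> \<open>The sign decides which of the two segments is listed first.\<close>
    consider "wedge ?u ?v > 0" | "wedge ?v ?u > 0"
      using chords_meet(1)[OF good l ne st eq] wedge_commute[of ?u ?v] by linarith
    then show "c \<in> chord_crossing m e ` ({..<m} \<times> cells m)"
    proof cases
      case 1
      from chords_meet_cell[OF good l ne st eq 1] show ?thesis unfolding c .
    next
      case 2
      from chords_meet_cell[OF good l(2,1) ne[symmetric] st(3,4,1,2) eq[symmetric] 2]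
      show ?thesis unfolding c eq insert_commute[of "(a, b)"] .
    qed
  qed
  moreover have "card (chord_crossing m e ` ({..<m} \<times> cells m)) \<le> m * card (cells m)"
    using card_image_le[of "{..<m} \<times> cells m" "chord_crossing m e"]
    by (simp add: card_cartesian_product finite_cells)
  ultimately show ?thesis
    by (meson card_mono finite_SigmaI finite_cells finite_imageI finite_lessThan finite_subset order_trans)
qed

subsection \<open>Layered drawings\<close>

definition link_edge :: "nat \<Rightarrow> nat \<times> nat \<Rightarrow> (nat \<times> nat) set" where
  "link_edge j x = {(fst x, j), (snd x, Suc j)}"

lemma link_edge_inject: "link_edge j x = link_edge k y \<longleftrightarrow> j = k \<and> x = y"
  by (cases x; cases y) (auto simp: link_edge_def doubleton_eq_iff)

lemma uverts_kronecker:
  "uverts (kronecker_product (complete_graph m) (path_graph n)) = {..<m} \<times> {..<n}"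
  by (simp add: kronecker_product_def complete_graph_def path_graph_def)

lemma uedges_kronecker:
  "uedges (kronecker_product (complete_graph m) (path_graph n)) =
     {link_edge j x | j x. Suc j < n \<and> x \<in> links m}" (is "?L = ?R")
proof (intro equalityI subsetI)
  fix e assume "e \<in> ?L"
  then obtain a b x y where e: "e = {(a, x), (b, y)}"
    and in_edges: "{a, b} \<in> uedges (complete_graph m)" "{x, y} \<in> uedges (path_graph n)"
    unfolding kronecker_product_def by auto
  have ab: "a < m" "b < m" "a \<noteq> b" and xy: "\<exists>j. {x, y} = {j, Suc j} \<and> Suc j < n"
    using in_edges by (auto simp: complete_graph_def path_graph_def doubleton_eq_iff)
  from xy obtain j where "Suc j < n" "x = j \<and> y = Suc j \<or> x = Suc j \<and> y = j"
    by (auto simp: doubleton_eq_iff)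
  then have "e = link_edge j (a, b) \<or> e = link_edge j (b, a)"
    unfolding e link_edge_def by auto
  then show "e \<in> ?R" using \<open>Suc j < n\<close> ab by (auto simp: links_def)
next
  fix e assume "e \<in> ?R"
  then obtain j a b where e: "e = {(a, j), (b, Suc j)}" and "Suc j < n" "a < m" "b < m" "a \<noteq> b"
    by (auto simp: link_edge_def links_def)
  then have "{a, b} \<in> uedges (complete_graph m)" "{j, Suc j} \<in> uedges (path_graph n)"
    by (auto simp: complete_graph_def path_graph_def)
  then show "e \<in> ?L" unfolding e by (auto simp: kronecker_product_def)
qed

lemma path_image_open:
  assumes "p \<in> path_image g"
  shows "p \<in> {pathstart g, pathfinish g} \<or> (\<exists>t. 0 < t \<and> t < 1 \<and> p = g t)"
proof -
  obtain t where "0 \<le> t" "t \<le> 1" "p = g t" using assms by (auto simp: path_image_def)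
  then consider "t = 0" | "t = 1" | "0 < t" "t < 1" by linarith
  then show ?thesis using \<open>p = g t\<close> by cases (auto simp: pathstart_def pathfinish_def)
qed

text \<open>Open curves of different edge layers run in disjoint regions, so each crossing involves
  two edges of the same layer.\<close>

lemma crossing_number_layered_le:
  fixes m n :: nat and pos :: "nat \<times> nat \<Rightarrow> complex" and c :: "nat \<Rightarrow> nat \<times> nat \<Rightarrow> real \<Rightarrow> complex"
  assumes inj: "inj_on pos ({..<m} \<times> {..<n})"
    and arcs: "\<And>j x. Suc j < n \<Longrightarrow> x \<in> links m \<Longrightarrow> arc (c j x)"
    and ends: "\<And>j x. Suc j < n \<Longrightarrow> x \<in> links m \<Longrightarrow>
      {pathstart (c j x), pathfinish (c j x)} = pos ` link_edge j x"
    and avoid: "\<And>j x t. Suc j < n \<Longrightarrow> x \<in> links m \<Longrightarrow> 0 < t \<Longrightarrow> t < 1 \<Longrightarrow>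
      c j x t \<notin> pos ` ({..<m} \<times> {..<n})"
    and region: "\<And>j x t. Suc j < n \<Longrightarrow> x \<in> links m \<Longrightarrow> 0 < t \<Longrightarrow> t < 1 \<Longrightarrow> c j x t \<in> R j"
    and disj: "\<And>j k. Suc j < n \<Longrightarrow> Suc k < n \<Longrightarrow> j \<noteq> k \<Longrightarrow> R j \<inter> R k = {}"
    and cross: "\<And>j. Suc j < n \<Longrightarrow>
      finite (layer_crossings m (c j)) \<and> card (layer_crossings m (c j)) \<le> N j"
  shows "crossing_number (kronecker_product (complete_graph m) (path_graph n)) \<le> (\<Sum>j<n - 1. N j)"
proof -
  let ?G = "kronecker_product (complete_graph m) (path_graph n)"
  let ?E = "\<lambda>(j, x). link_edge j x"
  \<comment> \<open>A drawing assigns curves to edges as sets; \<open>inv\<close> recovers the layer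
    and the link, since \<open>link_edge\<close> is injective in both.\<close>
  define crv where "crv e = (case inv ?E e of (j, x) \<Rightarrow> c j x)" for e
  have "inj ?E" by (auto simp: inj_on_def link_edge_inject)
  then have crv: "crv (link_edge j x) = c j x" for j x
    unfolding crv_def using inv_f_f[of ?E "(j, x)"] by simp
  have open_path: "\<exists>t. 0 < t \<and> t < 1 \<and> p = c j x t"
    if "Suc j < n" "x \<in> links m" "p \<in> path_image (c j x)" "p \<notin> pos ` link_edge j x" for j x p
    using path_image_open[OF that(3)] ends[OF that(1,2)] that(4) by auto
  have verts: "link_edge j x \<subseteq> {..<m} \<times> {..<n}" if "Suc j < n" "x \<in> links m" for j x
    using that by (auto simp: link_edge_def links_def)
  let ?X = "\<Union>j<n - 1. (\<lambda>(S, p). (link_edge j ` S, p)) ` layer_crossings m (c j)"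
  have sub: "crossings ?G pos crv \<subseteq> ?X"
  proof
    fix q assume "q \<in> crossings ?G pos crv"
    then obtain e f p where q': "q = ({e, f}, p)" "e \<noteq> f" and ef: "e \<in> uedges ?G" "f \<in> uedges ?G"
      and p': "p \<in> path_image (crv e) \<inter> path_image (crv f) - pos ` uverts ?G"
      unfolding crossings_def by blast
    obtain j x where e: "e = link_edge j x" and jx: "Suc j < n" "x \<in> links m"
      using ef(1) unfolding uedges_kronecker by blast
    obtain k y where f: "f = link_edge k y" and ky: "Suc k < n" "y \<in> links m"
      using ef(2) unfolding uedges_kronecker by blast
    have p: "p \<in> path_image (c j x)" "p \<in> path_image (c k y)" "p \<notin> pos ` ({..<m} \<times> {..<n})"
      using p' unfolding e f crv uverts_kronecker by auto
    note q = q'(1)[unfolded e f] and ne = q'(2)[unfolded e f]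
    obtain s t where s: "0 < s" "s < 1" "p = c j x s" and t: "0 < t" "t < 1" "p = c k y t"
      using open_path[OF jx p(1)] open_path[OF ky p(2)] p(3) verts[OF jx] verts[OF ky] by blast
    have "c j x s \<in> R j \<inter> R k" using region[OF jx s(1,2)] region[OF ky t(1,2)] s(3) t(3) by simp
    then have "j = k" using disj[OF jx(1) ky(1)] by blast
    with ne have "x \<noteq> y" by auto
    then have "({x, y}, p) \<in> layer_crossings m (c j)"
      using layer_crossingsI[of x m y s t "c j"] jx ky s t \<open>j = k\<close> by simp
    moreover have "q = (\<lambda>(S, p). (link_edge j ` S, p)) ({x, y}, p)" using q \<open>j = k\<close> by simp
    ultimately show "q \<in> ?X" using jx(1) by (intro UN_I[of j] image_eqI) auto
  qed
  have fin: "finite ?X" using cross by auto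
  have "card ?X \<le> (\<Sum>j<n - 1. card ((\<lambda>(S, p). (link_edge j ` S, p)) ` layer_crossings m (c j)))"
    by (rule card_UN_le) simp
  also have "\<dots> \<le> (\<Sum>j<n - 1. N j)"
  proof (rule sum_mono)
    fix j assume "j \<in> {..<n - 1}"
    then have "Suc j < n" by auto
    then show "card ((\<lambda>(S, p). (link_edge j ` S, p)) ` layer_crossings m (c j)) \<le> N j"
      using cross[of j] card_image_le order_trans by blast
  qed
  finally have X: "card ?X \<le> (\<Sum>j<n - 1. N j)" .
  have "drawing ?G pos crv"
    unfolding drawing_def
  proof (intro conjI ballI)
    show "inj_on pos (uverts ?G)" using inj by (simp add: uverts_kronecker)
    show "finite (crossings ?G pos crv)" using finite_subset[OF sub fin] .
    fix e assume "e \<in> uedges ?G"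
    then obtain j x where e: "e = link_edge j x" and jx: "Suc j < n" "x \<in> links m"
      by (auto simp: uedges_kronecker)
    show "arc (crv e)" using arcs[OF jx] by (simp add: e crv)
    show en: "{pathstart (crv e), pathfinish (crv e)} = pos ` e" using ends[OF jx] by (simp add: e crv)
    show "path_image (crv e) \<inter> pos ` uverts ?G = pos ` e"
    proof
      show "path_image (crv e) \<inter> pos ` uverts ?G \<subseteq> pos ` e"
      proof
        fix p assume p: "p \<in> path_image (crv e) \<inter> pos ` uverts ?G"
        show "p \<in> pos ` e"
        proof (rule ccontr)
          assume "p \<notin> pos ` e"
          then obtain t where "0 < t" "t < 1" "p = c j x t"
            using open_path[OF jx, of p] p unfolding e crv by auto
          then show False using avoid[OF jx, of t] p by (simp add: uverts_kronecker)
        qed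
      qed
      have "pos ` e \<subseteq> path_image (crv e)"
        unfolding en[symmetric] by (simp add: pathstart_in_path_image pathfinish_in_path_image)
      moreover have "pos ` e \<subseteq> pos ` uverts ?G"
        unfolding e uverts_kronecker using verts[OF jx] by (rule image_mono)
      ultimately show "pos ` e \<subseteq> path_image (crv e) \<inter> pos ` uverts ?G" by simp
    qed
  qed
  then have "crossing_number ?G \<le> card (crossings ?G pos crv)"
    unfolding crossing_number_def by (intro Least_le) blast
  also have "\<dots> \<le> card ?X" by (rule card_mono[OF fin sub])
  finally show ?thesis using X by simp
qed

text \<open>Transports a crossing bound along a map \<open>h\<close> that is injective on the open
  curves, with the links relabelled by \<sigma>. It serves both the scaling of the spirals and the
  inversion of the segments.\<close>

lemma layer_crossings_image:
  assumes fin: "finite (layer_crossings m F) \<and> card (layer_crossings m F) \<le> N"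
    and s: "\<And>x. x \<in> links m \<Longrightarrow> \<sigma> x \<in> links m"
    and \<tau>: "\<And>x. \<tau> (\<sigma> x) = x"
    and h: "\<And>x y s t. x \<in> links m \<Longrightarrow> y \<in> links m \<Longrightarrow> 0 < s \<Longrightarrow> s < 1 \<Longrightarrow> 0 < t \<Longrightarrow> t < 1 \<Longrightarrow>
      h (F x s) = h (F y t) \<Longrightarrow> F x s = F y t"
  shows "finite (layer_crossings m (\<lambda>x t. h (F (\<sigma> x) t))) \<and>
    card (layer_crossings m (\<lambda>x t. h (F (\<sigma> x) t))) \<le> N"
proof -
  have sub: "layer_crossings m (\<lambda>x t. h (F (\<sigma> x) t)) \<subseteq> (\<lambda>(S, p). (\<tau> ` S, h p)) ` layer_crossings m F"
  proof
    fix c assume "c \<in> layer_crossings m (\<lambda>x t. h (F (\<sigma> x) t))"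
    then obtain x y s t where c: "c = ({x, y}, h (F (\<sigma> x) s))" and xy: "x \<in> links m" "y \<in> links m" "x \<noteq> y"
      and st: "0 < s" "s < 1" "0 < t" "t < 1" and eq: "h (F (\<sigma> x) s) = h (F (\<sigma> y) t)"
      unfolding layer_crossings_def by blast
    have "F (\<sigma> x) s = F (\<sigma> y) t" using h[OF s[OF xy(1)] s[OF xy(2)] st eq] .
    moreover have "\<sigma> x \<noteq> \<sigma> y" using xy(3) \<tau> by metis
    ultimately have "({\<sigma> x, \<sigma> y}, F (\<sigma> x) s) \<in> layer_crossings m F"
      using layer_crossingsI s xy st by blast
    then show "c \<in> (\<lambda>(S, p). (\<tau> ` S, h p)) ` layer_crossings m F"
      by (rule rev_image_eqI) (simp add: c \<tau>)
  qed
  show ?thesis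
    using fin card_image_le[of "layer_crossings m F"] card_mono[OF _ sub] finite_subset[OF sub]
    by (meson finite_imageI order_trans)
qed

section \<open>The concrete drawing: positions, curves and regions\<close>

definition invert :: "nat \<Rightarrow> complex \<Rightarrow> complex" where
  "invert q z = of_real (exp (real q)) / cnj z"

lemma invert_eq_iff: "z \<noteq> 0 \<Longrightarrow> w \<noteq> 0 \<Longrightarrow> invert q z = invert q w \<longleftrightarrow> z = w"
  by (simp add: invert_def field_simps)

lemma norm_invert: "norm (invert q z) = exp (real q) / norm z"
  by (simp add: invert_def norm_divide)

text \<open>The inversion in the circle of radius \<open>exp (q / 2)\<close> keeps arguments and
  exchanges the unit circle with the circle of radius \<open>exp q\<close>.\<close>

lemma invert_rim: "invert q (rim m k) = exp (real q) *\<^sub>R rim m k"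
  by (simp add: invert_def rim_def cis_cnj divide_inverse scaleR_conv_of_real flip: cis_inverse)

text \<open>Layers \<open>1\<close> to \<open>n - 2\<close> have radii \<open>exp 0\<close> to
  \<open>exp (n - 3)\<close>; hence the exponent \<open>n - 3\<close>, with which the inversion
  sends the innermost of these circles to the outermost.\<close>

definition vertex_pos :: "real \<Rightarrow> nat \<Rightarrow> nat \<Rightarrow> nat \<times> nat \<Rightarrow> complex" where
  "vertex_pos e m n v =
     (if snd v = 0 then e *\<^sub>R centre m (int (fst v))
      else if snd v = n - 1 then invert (n - 3) (e *\<^sub>R centre m (int (fst v)))
      else exp (real (snd v - 1)) *\<^sub>R rim m (int (fst v)))"

text \<open>Segments start at central points. In the last edge layer the images of these belong to
  the second entry of a link, hence the swap.\<close>

definition edge_curve :: "real \<Rightarrow> nat \<Rightarrow> nat \<Rightarrow> nat \<Rightarrow> nat \<times> nat \<Rightarrow> real \<Rightarrow> complex" where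
  "edge_curve e m n j x =
     (if j = 0 then chord m e x
      else if j = n - 2 then invert (n - 3) \<circ> chord m e (prod.swap x)
      else (\<lambda>t. exp (real (j - 1)) *\<^sub>R spiral m x t))"

definition ring :: "nat \<Rightarrow> nat \<Rightarrow> complex set" where
  "ring n j = (if j = 0 then {z. norm z < 1}
     else if j = n - 2 then {z. norm z > exp (real (n - 3))}
     else {z. exp (real (j - 1)) < norm z \<and> norm z < exp (real j)})"

text \<open>
  In units of \<open>pi / m\<close> the angle between a central point and a rim point is an integer minus \<open>1 / 2\<close>, so the two
  are never antipodal.
\<close>

lemma chord_nonzero:
  assumes "0 < e" "e < 1" "0 < m" and t: "0 \<le> t" "t \<le> 1"
  shows "chord m e x t \<noteq> 0"
proof
  assume 0: "chord m e x t = 0"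
  let ?a = "int (fst x)" and ?b = "int (snd x)"
  have eq: "((1 - t) * e) *\<^sub>R centre m ?a = - (t *\<^sub>R rim m ?b)"
    using 0 by (simp add: chord_def linepath_def add_eq_0_iff2)
  have "norm (((1 - t) * e) *\<^sub>R centre m ?a) = norm (t *\<^sub>R rim m ?b)" unfolding eq by simp
  then have te: "(1 - t) * e = t" using t assms by simp
  then have "t \<noteq> 0" using assms by auto
  moreover have "t *\<^sub>R centre m ?a = t *\<^sub>R (- rim m ?b)" using eq te by simp
  ultimately have "centre m ?a = - rim m ?b" by (simp only: scaleR_cancel_left) simp
  also have "\<dots> = cis (2 * pi * real_of_int ?b / real m + pi)"
    by (simp add: rim_def flip: cis_mult)
  finally obtain N :: int where
    "pi * (2 * real_of_int ?a - 2 * real (m div 2) - 1 / 2) / real m = 2 * pi * real_of_int ?b / real m + pi + 2 * pi * N"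
    unfolding centre_def cis_eq_cis_iff by blast
  also have "\<dots> = pi * (2 * real_of_int ?b + m + 2 * m * N) / real m"
    using assms by (simp add: field_simps)
  finally have "2 * real_of_int ?a - 2 * real (m div 2) - 1 / 2 = 2 * real_of_int ?b + m + 2 * m * N"
    using assms by (simp only: divide_cancel_right mult_cancel_left) simp
  then have "real_of_int (4 * ?a - 4 * int (m div 2) - 1) = real_of_int (4 * ?b + 2 * m + 4 * (m * N))" by simp
  then have "4 * ?a - 4 * int (m div 2) - 1 = 4 * ?b + 2 * m + 4 * (m * N)" by linarith
  then show False by presburger
qed

lemma arc_chord:
  assumes "0 \<le> e" "e < 1"
  shows "arc (chord m e x)"
proof -
  have "norm (e *\<^sub>R centre m (int (fst x))) \<noteq> norm (rim m (int (snd x)))" using assms by simp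
  then show ?thesis unfolding chord_def by (intro arc_linepath notI) (simp only: simp_thms)
qed

lemma arc_invert:
  assumes "arc g" "0 \<notin> path_image g"
  shows "arc (invert q \<circ> g)"
  unfolding arc_def
proof
  have "continuous_on (path_image g) (invert q)"
    unfolding invert_def using assms(2) by (intro continuous_intros) auto
  then show "path (invert q \<circ> g)" using assms(1) by (intro path_continuous_image) (auto simp: arc_def)
  have "inj_on (invert q) (path_image g)"
    using assms(2) by (intro inj_onI) (metis invert_eq_iff)
  then show "inj_on (invert q \<circ> g) {0..1}"
    using assms(1) unfolding arc_def path_image_def by (intro comp_inj_on) auto
qed

lemma arc_spiral:
  assumes "0 < c"
  shows "arc (\<lambda>t. c *\<^sub>R spiral m x t)"
  unfolding arc_def path_def
proof
  have "continuous_on {0..1} (\<lambda>t. c *\<^sub>R (of_real (exp t) *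
      exp (\<i> * of_real (2 * pi * (real (fst x) + t * real_of_int (turn m x)) * inverse (real m)))))"
    by (intro continuous_intros)
  then show "continuous_on {0..1} (\<lambda>t. c *\<^sub>R spiral m x t)"
    by (simp add: spiral_def cis_conv_exp divide_inverse)
  show "inj_on (\<lambda>t. c *\<^sub>R spiral m x t) {0..1}"
    using assms by (intro inj_onI) (auto dest: spiral_time)
qed

lemma norm_spiral: "norm (spiral m x t) = exp t"
  by (simp add: spiral_def norm_mult)

lemma spiral_start: "spiral m x 0 = rim m (int (fst x))"
  by (simp add: spiral_def rim_def)

lemma spiral_end:
  assumes "x \<in> links m"
  shows "spiral m x 1 = exp 1 *\<^sub>R rim m (int (snd x))"
proof -
  have "0 < m" using assms by (auto simp: links_def)
  then have "rim m (int (fst x) + turn m x) = rim m (int (snd x))"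
    by (simp add: rim_eq_iff turn_def mod_simps)
  then show ?thesis by (simp add: spiral_def rim_def scaleR_conv_of_real)
qed

lemma chord_ends: "chord m e x 0 = e *\<^sub>R centre m (int (fst x))" "chord m e x 1 = rim m (int (snd x))"
  by (simp_all add: chord_def linepath_def)

text \<open>Another central point on the segment would be collinear with its two ends, which
  \<open>good_radius\<close> forbids; a return to its own start would put the rim point at norm
  \<open>e\<close>.\<close>

lemma chord_avoids_centres:
  assumes good: "good_radius m e" and x: "x \<in> links m" and a': "a' < m" and t: "0 < t"
  shows "chord m e x t \<noteq> e *\<^sub>R centre m (int a')"
proof
  obtain a b where ab: "x = (a, b)" by (cases x)
  let ?u = "rim m (int b) - e *\<^sub>R centre m (int a)" and ?d = "centre m (int a') - centre m (int a)"
  assume "chord m e x t = e *\<^sub>R centre m (int a')"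
  then have eq: "t *\<^sub>R ?u = e *\<^sub>R ?d" by (simp add: ab chord_eq algebra_simps)
  have e: "0 < e" "e < 1" using good by (auto simp: good_radius_def)
  show False
  proof (cases "a = a'")
    case True
    then have "rim m (int b) = e *\<^sub>R centre m (int a)" using eq t by simp
    then have "norm (rim m (int b)) = norm (e *\<^sub>R centre m (int a))" by simp
    then show False using e by simp
  next
    case False
    then have "wedge ?d ?u \<noteq> 0"
      using good x a' unfolding good_radius_def Let_def ab links_def by blast
    moreover have "wedge (t *\<^sub>R ?u) ?u = wedge (e *\<^sub>R ?d) ?u" unfolding eq ..
    then have "e * wedge ?d ?u = 0" unfolding wedge_simps(5) wedge_simps(7) by simp
    ultimately show False using e by simp
  qed
qed

lemma ring_lower: "z \<in> ring n j \<Longrightarrow> 0 < j \<Longrightarrow> 4 \<le> n \<Longrightarrow> exp (real (j - 1)) < norm z"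
  by (auto simp: ring_def numeral_eq_Suc split: if_splits)

lemma ring_upper: "z \<in> ring n j \<Longrightarrow> j < n - 2 \<Longrightarrow> norm z < exp (real j)"
  by (auto simp: ring_def split: if_splits)

lemma ring_disjoint:
  assumes "4 \<le> n" "Suc j < n" "Suc k < n" "j \<noteq> k"
  shows "ring n j \<inter> ring n k = {}"
proof -
  have *: "z \<notin> ring n k" if "z \<in> ring n j" "j < k" "Suc k < n" for z j k
  proof
    assume "z \<in> ring n k"
    then have "exp (real (k - 1)) < norm z" using ring_lower that assms(1) by simp
    also have "norm z < exp (real j)" using ring_upper[OF that(1)] that by simp
    finally show False using that by simp
  qed
  then show ?thesis using assms by (metis disjoint_iff linorder_neqE_nat)
qed

text \<open>The norm identifies the layer; the extra inequalities make the three cases mutually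
  exclusive by linear arithmetic.\<close>

lemma norm_vertex_pos:
  assumes "0 < e" "e < 1" "4 \<le> n" "j < n"
  shows "j = 0 \<and> norm (vertex_pos e m n (i, j)) < 1 \<or>
    0 < j \<and> j < n - 1 \<and> norm (vertex_pos e m n (i, j)) = exp (real (j - 1)) \<and>
      1 \<le> norm (vertex_pos e m n (i, j)) \<and> norm (vertex_pos e m n (i, j)) \<le> exp (real (n - 3)) \<or>
    j = n - 1 \<and> exp (real (n - 3)) < norm (vertex_pos e m n (i, j)) \<and> 1 < norm (vertex_pos e m n (i, j))"
proof -
  consider "j = 0" | "0 < j" "j < n - 1" | "j = n - 1" "j \<noteq> 0" using assms by linarith
  then show ?thesis
  proof cases
    case 2
    then have "j - 1 \<le> n - 3" by linarith
    then show ?thesis using 2 by (simp add: vertex_pos_def)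
  next
    case 3
    have "exp (real (n - 3)) < exp (real (n - 3)) / e" using assms by (simp add: pos_less_divide_eq)
    moreover have "1 \<le> exp (real (n - 3))" by simp
    ultimately have "exp (real (n - 3)) < exp (real (n - 3)) / e \<and> 1 < exp (real (n - 3)) / e" by linarith
    moreover have "norm (vertex_pos e m n (i, j)) = exp (real (n - 3)) / e"
      using 3 assms by (simp add: vertex_pos_def norm_invert)
    ultimately show ?thesis using 3 by (intro disjI2 conjI) (simp_all only:)
  qed (use assms in \<open>simp add: vertex_pos_def\<close>)
qed

lemma edge_curve_in_ring:
  assumes e: "0 < e" "e < 1" and x: "x \<in> links m" and t: "0 < t" "t < 1" and n: "4 \<le> n"
  shows "edge_curve e m n j x t \<in> ring n j"
proof -
  have m: "0 < m" using x by (auto simp: links_def)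
  have lt: "norm (chord m e y t) < 1" and gt: "0 < norm (chord m e y t)" for y
    using norm_chord_lt[of e t m y] chord_nonzero[OF e m, of t y] e t by auto
  consider "j = 0" | "j \<noteq> 0" "j = n - 2" | "j \<noteq> 0" "j \<noteq> n - 2" by blast
  then show ?thesis
  proof cases
    case 1
    then show ?thesis using lt by (simp add: edge_curve_def ring_def)
  next
    case 2
    then show ?thesis
      using lt[of "prod.swap x"] gt[of "prod.swap x"] unfolding edge_curve_def ring_def
      by (simp add: norm_invert pos_less_divide_eq)
  next
    case 3
    then obtain i where i: "j = Suc i" using not0_implies_Suc by blast
    have "exp (real i) * exp t < exp (real i) * exp 1" using t by simp
    then have "exp (real i) * exp t < exp (real j)" by (simp add: i flip: exp_add add.commute)
    then show ?thesis using 3 t by (simp add: i edge_curve_def ring_def norm_spiral)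
  qed
qed

lemma edge_curve_ends:
  assumes x: "x \<in> links m" and n: "4 \<le> n" and j: "Suc j < n"
  shows "{pathstart (edge_curve e m n j x), pathfinish (edge_curve e m n j x)} =
    vertex_pos e m n ` link_edge j x"
proof -
  consider "j = 0" | "j \<noteq> 0" "j = n - 2" | "j \<noteq> 0" "j \<noteq> n - 2" by blast
  then show ?thesis
  proof cases
    case 1
    then show ?thesis
      using n by (simp add: edge_curve_def link_edge_def vertex_pos_def pathstart_def pathfinish_def chord_ends
         insert_commute)
  next
    case 2
    then have "Suc j = n - 1" "j - 1 = n - 3" "j \<noteq> n - 1" using n by auto
    then show ?thesis
      using 2 n by (simp add: edge_curve_def link_edge_def vertex_pos_def pathstart_def pathfinish_def
         chord_ends invert_rim insert_commute)
  next
    case 3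
    then obtain i where i: "j = Suc i" using not0_implies_Suc by blast
    have "exp (real i) * exp 1 = exp (1 + real i)" by (simp add: exp_add)
    then show ?thesis
      using 3 n j x by (simp add: i edge_curve_def link_edge_def vertex_pos_def pathstart_def pathfinish_def
         spiral_start spiral_end insert_commute)
  qed
qed

lemma arc_edge_curve:
  assumes e: "0 < e" "e < 1" and x: "x \<in> links m"
  shows "arc (edge_curve e m n j x)"
proof -
  have m: "0 < m" using x by (auto simp: links_def)
  have "0 \<notin> path_image (chord m e y)" for y
    using chord_nonzero[OF e m, of _ y] by (force simp: path_image_def)
  then have "arc (invert (n - 3) \<circ> chord m e y)" for y
    using arc_chord arc_invert e by simp
  moreover have "arc (chord m e x)" using arc_chord e by simp
  moreover have "arc (\<lambda>t. exp (real (j - 1)) *\<^sub>R spiral m x t)" by (rule arc_spiral) simp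
  ultimately show ?thesis unfolding edge_curve_def by presburger
qed

lemma inj_vertex_pos:
  assumes e: "0 < e" "e < 1" and n: "4 \<le> n"
  shows "inj_on (vertex_pos e m n) ({..<m} \<times> {..<n})"
proof (rule inj_onI, clarsimp)
  fix i j i' j'
  assume v: "i < m" "j < n" "i' < m" "j' < n" and eq: "vertex_pos e m n (i, j) = vertex_pos e m n (i', j')"
  have jj: "j = j'"
    using norm_vertex_pos[OF e n v(2), of m i] norm_vertex_pos[OF e n v(4), of m i']
    unfolding eq by (elim disjE conjE) (linarith | simp)+
  have m: "0 < m" using v by simp
  have "int i mod int m = int i' mod int m"
    using eq e unfolding jj vertex_pos_def
    by (auto simp: centre_eq_iff[OF m] rim_eq_iff[OF m] invert_eq_iff split: if_splits)
  then show "i = i' \<and> j = j'" using v jj by simp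
qed

text \<open>Norms exclude all vertices except, for the first and last edge layers, the central
  points or their images; these are left to \<open>chord_avoids_centres\<close>.\<close>

lemma edge_curve_avoids:
  assumes good: "good_radius m e" and x: "x \<in> links m" and t: "0 < t" "t < 1" and n: "4 \<le> n" and j: "Suc j < n"
  shows "edge_curve e m n j x t \<notin> vertex_pos e m n ` ({..<m} \<times> {..<n})"
proof (clarsimp)
  fix i k assume i: "i < m" and k: "k < n" and eq: "edge_curve e m n j x t = vertex_pos e m n (i, k)"
  have e: "0 < e" "e < 1" using good by (auto simp: good_radius_def)
  have m: "0 < m" using i by simp
  note R = edge_curve_in_ring[OF e x t n, of j, unfolded eq]
  note V = norm_vertex_pos[OF e n k, of m i]
  have swap: "prod.swap x \<in> links m" using x by (auto simp: links_def)
  consider "j = 0" | "j \<noteq> 0" "j = n - 2" | "j \<noteq> 0" "j < n - 2" using j by linarith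
  then show False
  proof cases
    case 1
    then have "norm (vertex_pos e m n (i, k)) < 1" using R by (simp add: ring_def)
    then have "k = 0" using V by auto
    then have "chord m e x t = e *\<^sub>R centre m (int i)" using eq 1 by (simp add: edge_curve_def vertex_pos_def)
    then show False using chord_avoids_centres[OF good x i t(1)] by simp
  next
    case 2
    then have "exp (real (n - 3)) < norm (vertex_pos e m n (i, k))" using R by (simp add: ring_def)
    moreover have "1 \<le> exp (real (n - 3))" by simp
    ultimately have "k = n - 1" using V by linarith
    then have "invert (n - 3) (chord m e (prod.swap x) t) = invert (n - 3) (e *\<^sub>R centre m (int i))"
      using eq 2 n by (simp add: edge_curve_def vertex_pos_def)
    moreover have "chord m e (prod.swap x) t \<noteq> 0" using chord_nonzero[OF e m, of t "prod.swap x"] t by simp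
    moreover have "e *\<^sub>R centre m (int i) \<noteq> 0" using e by simp
    ultimately have "chord m e (prod.swap x) t = e *\<^sub>R centre m (int i)" by (simp add: invert_eq_iff)
    then show False using chord_avoids_centres[OF good swap i t(1)] by simp
  next
    case 3
    then have between: "exp (real (j - 1)) < norm (vertex_pos e m n (i, k))" "norm (vertex_pos e m n (i, k)) < exp (real j)"
      using R by (auto simp: ring_def)
    have "1 \<le> exp (real (j - 1))" "exp (real j) \<le> exp (real (n - 3))" using 3 by simp_all
    then have "k \<noteq> 0" "k \<noteq> n - 1" using V between n by linarith+
    then have "norm (vertex_pos e m n (i, k)) = exp (real (k - 1))" using V by blast
    \<comment> \<open>No integer lies strictly between the exponents of two neighbouring
      circles.\<close>
    then have "j - 1 < k - 1" "k - 1 < j" using between by simp_all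
    then show False by simp
  qed
qed

lemma layer_crossings_edge_curve:
  assumes good: "good_radius m e" and n: "4 \<le> n"
  shows "finite (layer_crossings m (edge_curve e m n j)) \<and> card (layer_crossings m (edge_curve e m n j)) \<le>
    (if j = 0 \<or> j = n - 2 then m * card (cells m) else m * ((m - 1) choose 3))"
proof -
  have e: "0 < e" "e < 1" using good by (auto simp: good_radius_def)
  consider "j = 0" | "j \<noteq> 0" "j = n - 2" | "j \<noteq> 0" "j \<noteq> n - 2" by blast
  then show ?thesis
  proof cases
    case 1
    then show ?thesis using layer_crossings_chord[OF good] by (simp add: edge_curve_def[abs_def])
  next
    case 2
    have "finite (layer_crossings m (\<lambda>x t. invert (n - 3) (chord m e (prod.swap x) t))) \<and>
      card (layer_crossings m (\<lambda>x t. invert (n - 3) (chord m e (prod.swap x) t))) \<le> m * card (cells m)"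
    proof (rule layer_crossings_image[OF layer_crossings_chord[OF good], where \<tau> = prod.swap])
      fix x y s t assume "x \<in> links m" "y \<in> links m" "0 < s" "s < 1" "0 < t" "t < (1::real)"
        "invert (n - 3) (chord m e x s) = invert (n - 3) (chord m e y t)"
      moreover from this have "0 < m" by (auto simp: links_def)
      ultimately show "chord m e x s = chord m e y t"
        using chord_nonzero[OF e, of m s x] chord_nonzero[OF e, of m t y] invert_eq_iff by force
    qed (auto simp: links_def)
    moreover have "edge_curve e m n j = (\<lambda>x t. invert (n - 3) (chord m e (prod.swap x) t))"
      using 2 by (auto simp: edge_curve_def fun_eq_iff)
    ultimately show ?thesis using 2 by simp
  next
    case 3
    have "finite (layer_crossings m (\<lambda>x t. exp (real (j - 1)) *\<^sub>R spiral m (id x) t)) \<and>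
      card (layer_crossings m (\<lambda>x t. exp (real (j - 1)) *\<^sub>R spiral m (id x) t)) \<le> m * ((m - 1) choose 3)"
      by (rule layer_crossings_image[OF layer_crossings_spiral, where \<tau> = id]) auto
    moreover have "edge_curve e m n j = (\<lambda>x t. exp (real (j - 1)) *\<^sub>R spiral m (id x) t)"
      using 3 by (auto simp: edge_curve_def fun_eq_iff)
    ultimately show ?thesis using 3 by simp
  qed
qed

text \<open>Of the \<open>n - 1\<close> edge layers the first and the last consist of segments, the
  other \<open>n - 3\<close> of spirals.\<close>

lemma crossing_number_kronecker_le:
  assumes n: "4 \<le> n"
  shows "crossing_number (kronecker_product (complete_graph m) (path_graph n)) \<le>
    2 * (m * card (cells m)) + (n - 3) * (m * ((m - 1) choose 3))"
proof -
  obtain e where good: "good_radius m e" using good_radius_ex by blast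
  have e: "0 < e" "e < 1" using good by (auto simp: good_radius_def)
  define N where "N j = (if j = 0 \<or> j = n - 2 then m * card (cells m) else m * ((m - 1) choose 3))" for j
  have "crossing_number (kronecker_product (complete_graph m) (path_graph n)) \<le> (\<Sum>j<n - 1. N j)"
  proof (rule crossing_number_layered_le[where R = "ring n" and pos = "vertex_pos e m n" and c = "edge_curve e m n"])
    show "inj_on (vertex_pos e m n) ({..<m} \<times> {..<n})" by (rule inj_vertex_pos[OF e n])
  qed (use arc_edge_curve[OF e] edge_curve_ends[OF _ n] edge_curve_avoids[OF good _ _ _ n]
      edge_curve_in_ring[OF e _ _ _ n] ring_disjoint[OF n] layer_crossings_edge_curve[OF good n] in
      \<open>simp_all add: N_def\<close>)
  also have "{..<n - 1} = insert 0 (insert (n - 2) {1..<n - 2})" using n by auto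
  also have "sum N \<dots> = N 0 + (N (n - 2) + sum N {1..<n - 2})" using n by simp
  also have "sum N {1..<n - 2} = (n - 3) * (m * ((m - 1) choose 3))"
    by (simp add: N_def)
  finally show ?thesis by (simp add: N_def)
qed

section \<open>Comparison with the stated bounds\<close>

lemma choose_three: "6 * real (k choose 3) = real k * (real k - 1) * (real k - 2)"
proof (induction k)
  case (Suc k)
  have "2 * real (k choose 2) = real k * (real k - 1)"
    by (induction k) (simp_all add: numeral_2_eq_2 algebra_simps)
  then show ?case using Suc by (simp add: eval_nat_numeral algebra_simps)
qed simp

text \<open>Up to a factor \<open>1 / 3\<close> this product, at \<open>r\<close> for odd and at
  \<open>r - 1\<close> for even \<open>m\<close>, is the slack between the cell count and the stated
  bound. It vanishes at \<open>1\<close>, \<open>2\<close>, \<open>3\<close>.\<close>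

lemma three_consecutive_nonneg:
  fixes k :: nat
  assumes "1 \<le> k"
  shows "0 \<le> (real k - 1) * (real k - 2) * (real k - 3)"
proof -
  consider "k = 1" | "k = 2" | "3 \<le> k" using assms by linarith
  then show ?thesis by cases auto
qed

theorem theorem2p1:
  fixes n :: nat
  assumes "n \<ge> 4"
  shows "(\<forall>m::nat. m \<ge> 5 \<and> odd m \<longrightarrow>
            real (crossing_number (kronecker_product (complete_graph m) (path_graph n)))
              \<le> (real n - 1) * real m * (real m - 1) * (real m - 2) * (real m - 3) / 6
                - real m * (real m - 3) * ((real m)^2 + 6 * real m - 31) / 24)
       \<and> (\<forall>m::nat. m \<ge> 4 \<and> even m \<longrightarrow>
            real (crossing_number (kronecker_product (complete_graph m) (path_graph n)))
              \<le> (real n - 1) * real m * (real m - 1) * (real m - 2) * (real m - 3) / 6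
                - real m * (real m - 4) * ((real m)^2 + 10 * real m - 48) / 24)"
proof (intro conjI allI impI; elim conjE)
  \<comment> \<open>The common factor \<open>m\<close> is pulled out, so that only the cell counts
    remain to be compared.\<close>
  have bound: "real (crossing_number (kronecker_product (complete_graph m) (path_graph n)))
      \<le> real m * (2 * real (card (cells m)) + (real n - 3) * ((real m - 1) * (real m - 2) * (real m - 3) / 6))"
    if "0 < m" for m
  proof -
    have "real ((m - 1) choose 3) = (real m - 1) * (real m - 2) * (real m - 3) / 6"
      using choose_three[of "m - 1"] that by (simp add: of_nat_diff)
    then have ch: "real m * (2 * real (card (cells m)) + (real n - 3) * ((real m - 1) * (real m - 2) * (real m - 3) / 6))
        = real (2 * (m * card (cells m)) + (n - 3) * (m * ((m - 1) choose 3)))"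
      using assms by (simp only: of_nat_add of_nat_mult of_nat_diff) (simp add: of_nat_diff algebra_simps)
    show ?thesis unfolding ch of_nat_le_iff by (rule crossing_number_kronecker_le[OF assms])
  qed
  {
    fix m :: nat assume m: "5 \<le> m" "odd m"
    then obtain r where r: "m = Suc (2 * r)" using oddE by fastforce
    have "real_of_int (2 * int (card (cells m))) \<le> real_of_int (int r * (int r - 1) * (2 * int r - 1))"
      using card_cells_odd[of r] unfolding r of_int_le_iff .
    \<comment> \<open>An exact identity in \<open>r\<close>, whose last term is the slack to be
      dropped.\<close>
    also have "\<dots> = 2 * ((real m - 1) * (real m - 2) * (real m - 3) / 6) - (real m - 3) * ((real m)^2 + 6 * real m - 31) / 24
        - (real r - 1) * (real r - 2) * (real r - 3) / 3"
      by (simp add: r power2_eq_square field_simps)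
    also have "\<dots> \<le> 2 * ((real m - 1) * (real m - 2) * (real m - 3) / 6) - (real m - 3) * ((real m)^2 + 6 * real m - 31) / 24"
      using three_consecutive_nonneg[of r] m r by simp
    finally have "real m * (2 * real (card (cells m)) + (real n - 3) * ((real m - 1) * (real m - 2) * (real m - 3) / 6))
      \<le> real m * (2 * ((real m - 1) * (real m - 2) * (real m - 3) / 6) - (real m - 3) * ((real m)^2 + 6 * real m - 31) / 24
         + (real n - 3) * ((real m - 1) * (real m - 2) * (real m - 3) / 6))"
      by (intro mult_left_mono add_right_mono) simp_all
    also have "\<dots> = (real n - 1) * real m * (real m - 1) * (real m - 2) * (real m - 3) / 6
                - real m * (real m - 3) * ((real m)^2 + 6 * real m - 31) / 24"
      by (simp add: field_simps)
    finally show "real (crossing_number (kronecker_product (complete_graph m) (path_graph n)))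
              \<le> (real n - 1) * real m * (real m - 1) * (real m - 2) * (real m - 3) / 6
                - real m * (real m - 3) * ((real m)^2 + 6 * real m - 31) / 24"
      using bound[of m] m by linarith
  next
    fix m :: nat assume m: "4 \<le> m" "even m"
    then obtain r where r: "m = 2 * r" by blast
    have r1: "real (r - 1) = real r - 1" using m r by simp
    have "real (card (cells m)) \<le> real ((r - 1) ^ 3)"
      using card_cells_even[of r] unfolding r of_nat_le_iff .
    then have "2 * real (card (cells m)) \<le> 2 * (real r - 1) ^ 3" unfolding of_nat_power r1 by linarith
    also have "\<dots> = 2 * ((real m - 1) * (real m - 2) * (real m - 3) / 6) - (real m - 4) * ((real m)^2 + 10 * real m - 48) / 24
        - (real (r - 1) - 1) * (real (r - 1) - 2) * (real (r - 1) - 3) / 3"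
      unfolding r1 by (simp add: r power3_eq_cube power2_eq_square field_simps)
    also have "\<dots> \<le> 2 * ((real m - 1) * (real m - 2) * (real m - 3) / 6) - (real m - 4) * ((real m)^2 + 10 * real m - 48) / 24"
      using three_consecutive_nonneg[of "r - 1"] m r by simp
    finally have "real m * (2 * real (card (cells m)) + (real n - 3) * ((real m - 1) * (real m - 2) * (real m - 3) / 6))
      \<le> real m * (2 * ((real m - 1) * (real m - 2) * (real m - 3) / 6) - (real m - 4) * ((real m)^2 + 10 * real m - 48) / 24
         + (real n - 3) * ((real m - 1) * (real m - 2) * (real m - 3) / 6))"
      by (intro mult_left_mono add_right_mono) simp_all
    also have "\<dots> = (real n - 1) * real m * (real m - 1) * (real m - 2) * (real m - 3) / 6
                - real m * (real m - 4) * ((real m)^2 + 10 * real m - 48) / 24"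
      by (simp add: field_simps)
    finally show "real (crossing_number (kronecker_product (complete_graph m) (path_graph n)))
              \<le> (real n - 1) * real m * (real m - 1) * (real m - 2) * (real m - 3) / 6
                - real m * (real m - 4) * ((real m)^2 + 10 * real m - 48) / 24"
      using bound[of m] m by linarith
  }
qed

end
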